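(* Let $A = \{ a \in N : p(a u_k - a) + p(u_k a - a) \to 0 \text{ as } k \to \infty\}$. Then $A$ is a semisimple operator algebra with contractive approximate identity $(u_k)_{k \in \mathbb{N}}$, and $A_0$ is an ideal in $A$.
   Context: An operator algebra is a norm-closed subalgebra of $B(H)$ for a Hilbert space $H$. A contractive approximate identity (cai) is a (two-sided) approximate identity consisting of elements of norm $\le 1$. Here $\mathbb{N}=\{1,2,\dots\}$, $\mathbb{N}_0 = \mathbb{N}\cup\{0\}$, $M_n=M_n(\mathbb{C})$ with operator norm $\|\cdot\|$. Let $(c_n)$ be an unbounded increasing sequence in $(0,\infty)$ with $c_n > 1$ for all $n$. Let $d_n \in M_n$ be the diagonal matrix whose $k$th diagonal entry is $c_n^k$. Let $M$ be the von Neumann algebra $\oplus_n^\infty (M_n \oplus M_n)$ ($\ell^\infty$-direct sum), and let $N \subset M$ be the weak*-closed unital subalgebra of all tuples $((x_n, d_n x_n d_n^{-1}))_n$ that lie in $M$, with $(x_n) \in \oplus_n^\infty M_n$; such a tuple is also written simply $(x_n)$. The norm on $N$ is $p((x_n)) = \sup_n p_n(x_n)$, where $p_n(x) = \max\{\|x\|, \|d_n x d_n^{-1}\|\}$ for $x \in M_n$. Let $A_{00}$ be the set of finitely supported tuples in $N$ and $A_0$ the norm closure of $A_{00}$. Let $L_n \in M_n$ be the left shift on $\mathbb{C}^n$ ($L_n e_1 = 0$, $L_n e_{j+1} = e_j$). For $n \ge k$ put $E_{n,k} = \mathbb{N}_0 \cap [\frac{n}{k}, \frac{2n}{k}]$,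 $\mu_{n,k} = |E_{n,k}|$, and $u_{n,k} = \frac{1}{\mu_{n,k}} \sum_{i \in E_{n,k}} (L_n)^i$; for $n < k$ put $u_{n,k} = I_n$. Set $u_k = (u_{n,k})_{n \in \mathbb{N}} \in N$. *)

theory Defs
  imports "HOL-Analysis.Analysis" "Jordan_Normal_Form.Matrix"
begin

section \<open>Complex Hilbert spaces and operator algebras\<close>

text \<open>The inner product \<open>cinner\<close> is linear in the first argument. The last axiom makes the norm,
  which the class \<open>real_inner\<close> derives from \<open>inner\<close>, the one induced by \<open>cinner\<close>.\<close>

class complex_hilbert = real_inner + complete_space +
  fixes scaleC :: "complex \<Rightarrow> 'a \<Rightarrow> 'a" (infixr "*\<^sub>C" 75)
    and cinner :: "'a \<Rightarrow> 'a \<Rightarrow> complex"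
  assumes scaleC_add_right: "a *\<^sub>C (x + y) = a *\<^sub>C x + a *\<^sub>C y"
    and scaleC_add_left: "(a + b) *\<^sub>C x = a *\<^sub>C x + b *\<^sub>C x"
    and scaleC_scaleC: "a *\<^sub>C (b *\<^sub>C x) = (a * b) *\<^sub>C x"
    and scaleC_of_real: "complex_of_real r *\<^sub>C x = r *\<^sub>R x"
    and cinner_commute: "cinner x y = cnj (cinner y x)"
    and cinner_add_left: "cinner (x + y) z = cinner x z + cinner y z"
    and cinner_scaleC_left: "cinner (a *\<^sub>C x) y = a * cinner x y"
    and inner_eq_Re_cinner: "inner x y = Re (cinner x y)"

text \<open>The type \<open>'h \<Rightarrow>\<^sub>L 'h\<close> consists of the bounded real-linear maps with the operator norm;
  \<open>B(H)\<close> is its subset of complex-linear maps.\<close>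

definition bounded_operators :: "('h::complex_hilbert \<Rightarrow>\<^sub>L 'h) set" where
  "bounded_operators = {T. \<forall>a v. blinfun_apply T (a *\<^sub>C v) = a *\<^sub>C blinfun_apply T v}"

definition scale_op :: "complex \<Rightarrow> ('h::complex_hilbert \<Rightarrow>\<^sub>L 'h) \<Rightarrow> ('h \<Rightarrow>\<^sub>L 'h)" where
  "scale_op a T = Blinfun (\<lambda>v. a *\<^sub>C blinfun_apply T v)"

definition operator_algebra :: "('h::complex_hilbert \<Rightarrow>\<^sub>L 'h) set \<Rightarrow> bool" where
  "operator_algebra S \<longleftrightarrow>
     S \<subseteq> bounded_operators \<and> 0 \<in> S \<and>
     (\<forall>T\<in>S. \<forall>U\<in>S. T + U \<in> S) \<and>
     (\<forall>a. \<forall>T\<in>S. scale_op a T \<in> S) \<and>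
     (\<forall>T\<in>S. \<forall>U\<in>S. T o\<^sub>L U \<in> S) \<and>
     closed S"


section \<open>The Hilbert space on which \<open>M\<close> acts\<close>

text \<open>\<open>hsum\<close> is the Hilbert space direct sum of the spaces \<open>\<complex>\<^sup>n \<oplus> \<complex>\<^sup>n\<close>. A vector is a square-summable
  family of coordinates indexed by triples \<open>(n, b, i)\<close> with \<open>i < n\<close>, where \<open>b\<close> selects the first
  (\<open>False\<close>) or second (\<open>True\<close>) copy of \<open>\<complex>\<^sup>n\<close>; coordinates at other triples are zero. In particular
  \<open>n = 0\<close> contributes nothing.\<close>

type_synonym idx = "nat \<times> bool \<times> nat"

definition is_idx :: "idx \<Rightarrow> bool" where
  "is_idx t \<longleftrightarrow> (case t of (n, b, i) \<Rightarrow> i < n)"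

definition sqsum :: "(idx \<Rightarrow> complex) \<Rightarrow> bool" where
  "sqsum f \<longleftrightarrow> (\<lambda>t. (cmod (f t))\<^sup>2) summable_on UNIV"

lemma sqsum_mult:
  assumes "sqsum f" "sqsum g"
  shows "(\<lambda>t. f t * cnj (g t)) summable_on UNIV"
proof -
  have "(\<lambda>t. (cmod (f t))\<^sup>2 + (cmod (g t))\<^sup>2) summable_on UNIV"
    using assms unfolding sqsum_def by (rule summable_on_add)
  moreover have "norm (f t * cnj (g t)) \<le> (cmod (f t))\<^sup>2 + (cmod (g t))\<^sup>2" for t
  proof -
    have "2 * (cmod (f t) * cmod (g t)) \<le> (cmod (f t))\<^sup>2 + (cmod (g t))\<^sup>2"
      using sum_squares_bound[of "cmod (f t)" "cmod (g t)"] by (simp add: mult.assoc)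
    moreover have "0 \<le> cmod (f t) * cmod (g t)" by simp
    ultimately show ?thesis unfolding norm_mult complex_mod_cnj by linarith
  qed
  ultimately have "(\<lambda>t. norm (f t * cnj (g t))) summable_on UNIV"
    by (rule summable_on_comparison_test) (rule norm_ge_zero)
  then show ?thesis by (rule abs_summable_summable)
qed

lemma sqsum_scale: "sqsum f \<Longrightarrow> sqsum (\<lambda>t. a * f t)"
  unfolding sqsum_def by (simp add: norm_mult power_mult_distrib summable_on_cmult_right)

lemma sqsum_add:
  assumes "sqsum f" "sqsum g"
  shows "sqsum (\<lambda>t. f t + g t)"
  unfolding sqsum_def
proof (rule summable_on_comparison_test)
  show "(\<lambda>t. 2 * (cmod (f t))\<^sup>2 + 2 * (cmod (g t))\<^sup>2) summable_on UNIV"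
    using assms unfolding sqsum_def by (intro summable_on_add summable_on_cmult_right)
  fix t
  have "(cmod (f t + g t))\<^sup>2 \<le> (cmod (f t) + cmod (g t))\<^sup>2"
    by (intro power_mono norm_triangle_ineq) auto
  also have "\<dots> \<le> 2 * (cmod (f t))\<^sup>2 + 2 * (cmod (g t))\<^sup>2"
    using sum_squares_bound[of "cmod (f t)" "cmod (g t)"] by (simp add: power2_sum)
  finally show "(cmod (f t + g t))\<^sup>2 \<le> 2 * (cmod (f t))\<^sup>2 + 2 * (cmod (g t))\<^sup>2" .
qed auto

typedef hsum = "{f. sqsum f \<and> (\<forall>t. \<not> is_idx t \<longrightarrow> f t = 0)}"
  morphisms coord Hsum
proof
  show "(\<lambda>_. 0) \<in> {f. sqsum f \<and> (\<forall>t. \<not> is_idx t \<longrightarrow> f t = 0)}"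
    by (simp add: sqsum_def)
qed

setup_lifting type_definition_hsum

lemma sqsum_coord: "sqsum (coord x)"
  using coord[of x] by simp

lift_definition hscale :: "complex \<Rightarrow> hsum \<Rightarrow> hsum" is "\<lambda>a f t. a * f t"
  by (simp add: sqsum_scale)

definition hinner :: "hsum \<Rightarrow> hsum \<Rightarrow> complex" where
  "hinner x y = (\<Sum>\<^sub>\<infinity>t. coord x t * cnj (coord y t))"

instantiation hsum :: real_inner
begin

lift_definition zero_hsum :: hsum is "\<lambda>_. 0"
  by (simp add: sqsum_def)

lift_definition scaleR_hsum :: "real \<Rightarrow> hsum \<Rightarrow> hsum" is "\<lambda>r f t. complex_of_real r * f t"
  by (simp add: sqsum_scale)

lift_definition plus_hsum :: "hsum \<Rightarrow> hsum \<Rightarrow> hsum" is "\<lambda>f g t. f t + g t"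
  by (simp add: sqsum_add)

lift_definition uminus_hsum :: "hsum \<Rightarrow> hsum" is "\<lambda>f t. - f t"
  by (simp add: sqsum_def)

lift_definition minus_hsum :: "hsum \<Rightarrow> hsum \<Rightarrow> hsum" is "\<lambda>f g t. f t - g t"
proof -
  fix f g :: "idx \<Rightarrow> complex"
  assume "sqsum f \<and> (\<forall>t. \<not> is_idx t \<longrightarrow> f t = 0)" "sqsum g \<and> (\<forall>t. \<not> is_idx t \<longrightarrow> g t = 0)"
  then show "sqsum (\<lambda>t. f t - g t) \<and> (\<forall>t. \<not> is_idx t \<longrightarrow> f t - g t = 0)"
    using sqsum_add[of f "\<lambda>t. -1 * g t"] sqsum_scale[of g "-1"] by simp
qed

definition inner_hsum :: "hsum \<Rightarrow> hsum \<Rightarrow> real" where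
  "inner_hsum x y = Re (hinner x y)"

definition norm_hsum :: "hsum \<Rightarrow> real" where
  "norm_hsum x = sqrt (inner x x)"

definition dist_hsum :: "hsum \<Rightarrow> hsum \<Rightarrow> real" where
  "dist_hsum x y = norm (x - y)"

definition sgn_hsum :: "hsum \<Rightarrow> hsum" where
  "sgn_hsum x = inverse (norm x) *\<^sub>R x"

definition uniformity_hsum :: "(hsum \<times> hsum) filter" where
  "uniformity_hsum = (INF e\<in>{0<..}. principal {(x, y). dist x y < e})"

definition open_hsum :: "hsum set \<Rightarrow> bool" where
  "open_hsum U \<longleftrightarrow> (\<forall>x\<in>U. \<forall>\<^sub>F (x', y) in uniformity. x' = x \<longrightarrow> y \<in> U)"

lemma cinner_hsum_self: "hinner x x = complex_of_real (\<Sum>\<^sub>\<infinity>t. (cmod (coord x t))\<^sup>2)"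
proof -
  have "((\<lambda>t. (cmod (coord x t))\<^sup>2) has_sum (\<Sum>\<^sub>\<infinity>t. (cmod (coord x t))\<^sup>2)) UNIV"
    using sqsum_coord[of x] unfolding sqsum_def by (rule has_sum_infsum)
  then have "((\<lambda>t. complex_of_real ((cmod (coord x t))\<^sup>2)) has_sum
      complex_of_real (\<Sum>\<^sub>\<infinity>t. (cmod (coord x t))\<^sup>2)) UNIV"
    by (rule has_sum_of_real)
  then have "((\<lambda>t. coord x t * cnj (coord x t)) has_sum
      complex_of_real (\<Sum>\<^sub>\<infinity>t. (cmod (coord x t))\<^sup>2)) UNIV"
    by (simp only: complex_norm_square)
  then show ?thesis
    unfolding hinner_def by (rule infsumI)
qed

lemma cinner_add_left_hsum:
  fixes x y z :: hsum
  shows "hinner (x + y) z = hinner x z + hinner y z"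
proof -
  have "(\<Sum>\<^sub>\<infinity>t. coord x t * cnj (coord z t) + coord y t * cnj (coord z t)) =
      (\<Sum>\<^sub>\<infinity>t. coord x t * cnj (coord z t)) + (\<Sum>\<^sub>\<infinity>t. coord y t * cnj (coord z t))"
    by (intro infsum_add sqsum_mult sqsum_coord)
  then show ?thesis
    unfolding hinner_def plus_hsum.rep_eq by (simp add: distrib_right)
qed

lemma cinner_scaleC_left_hsum:
  fixes x y :: hsum
  shows "hinner (hscale a x) y = a * hinner x y"
  unfolding hinner_def hscale.rep_eq by (simp add: mult.assoc infsum_cmult_right')

lemma cinner_commute_hsum:
  fixes x y :: hsum
  shows "hinner x y = cnj (hinner y x)"
  unfolding hinner_def by (simp flip: infsum_cnj add: mult.commute)

lemma scaleC_of_real_hsum: "hscale (complex_of_real r) x = r *\<^sub>R (x::hsum)"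
  by transfer simp

lemma norm_hsum_sq: "(norm (x::hsum))\<^sup>2 = (\<Sum>\<^sub>\<infinity>t. (cmod (coord x t))\<^sup>2)"
  unfolding norm_hsum_def inner_hsum_def cinner_hsum_self
  by (simp add: infsum_nonneg)

lemma norm_hsum_ge0: "norm (x::hsum) \<ge> 0"
  unfolding norm_hsum_def inner_hsum_def cinner_hsum_self
  by (simp add: infsum_nonneg)

lemma finite_sum_le_norm_hsum:
  assumes "finite F"
  shows "(\<Sum>t\<in>F. (cmod (coord x t))\<^sup>2) \<le> (norm (x::hsum))\<^sup>2"
  unfolding norm_hsum_sq
  by (rule finite_sum_le_infsum) (use assms sqsum_coord[of x] in \<open>auto simp: sqsum_def\<close>)

lemma norm_hsum_le:
  assumes "\<And>F. finite F \<Longrightarrow> (\<Sum>t\<in>F. (cmod (coord x t))\<^sup>2) \<le> B\<^sup>2" "B \<ge> 0"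
  shows "norm (x::hsum) \<le> B"
proof -
  have "(norm x)\<^sup>2 \<le> B\<^sup>2"
    unfolding norm_hsum_sq
    by (rule infsum_le_finite_sums) (use assms sqsum_coord[of x] in \<open>auto simp: sqsum_def\<close>)
  then show ?thesis using assms(2) by (rule power2_le_imp_le)
qed

lemma coord_le_norm: "cmod (coord x t) \<le> norm (x::hsum)"
  using finite_sum_le_norm_hsum[of "{t}" x] norm_hsum_ge0 by (auto intro: power2_le_imp_le)

lemma hsum_complete:
  fixes X :: "nat \<Rightarrow> hsum"
  assumes C: "\<And>e. e > 0 \<Longrightarrow> \<exists>M. \<forall>m\<ge>M. \<forall>n\<ge>M. norm (X m - X n) < e"
  shows "\<exists>L. \<forall>e>0. \<exists>M. \<forall>n\<ge>M. norm (X n - L) \<le> e"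
proof -
  have "Cauchy (\<lambda>n. coord (X n) t)" for t
  proof (rule CauchyI)
    fix e :: real assume "e > 0"
    then obtain M where M: "\<forall>m\<ge>M. \<forall>n\<ge>M. norm (X m - X n) < e" using C by blast
    then have "\<forall>m\<ge>M. \<forall>n\<ge>M. norm (coord (X m) t - coord (X n) t) < e"
      using coord_le_norm[of "X _ - X _" t] unfolding minus_hsum.rep_eq by (meson le_less_trans)
    then show "\<exists>M. \<forall>m\<ge>M. \<forall>n\<ge>M. norm (coord (X m) t - coord (X n) t) < e" by blast
  qed
  then have "\<exists>l. (\<lambda>n. coord (X n) t) \<longlonglongrightarrow> l" for t
    by (simp add: Cauchy_convergent_iff convergent_def)
  then obtain f where f: "\<And>t. (\<lambda>n. coord (X n) t) \<longlonglongrightarrow> f t" by metis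
  have bound: "(\<Sum>t\<in>F. (cmod (coord (X m) t - f t))\<^sup>2) \<le> e\<^sup>2"
    if "finite F" "\<forall>n\<ge>M. norm (X m - X n) < e" for F m M e
  proof (rule LIMSEQ_le_const2)
    show "(\<lambda>n. \<Sum>t\<in>F. (cmod (coord (X m) t - coord (X n) t))\<^sup>2) \<longlonglongrightarrow>
        (\<Sum>t\<in>F. (cmod (coord (X m) t - f t))\<^sup>2)"
      by (intro tendsto_intros f)
    have "(\<Sum>t\<in>F. (cmod (coord (X m) t - coord (X n) t))\<^sup>2) \<le> e\<^sup>2" if "n \<ge> M" for n
    proof -
      have "(\<Sum>t\<in>F. (cmod (coord (X m) t - coord (X n) t))\<^sup>2) \<le> (norm (X m - X n))\<^sup>2"
        using finite_sum_le_norm_hsum[OF \<open>finite F\<close>, of "X m - X n"] by (simp add: minus_hsum.rep_eq)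
      also have "\<dots> \<le> e\<^sup>2"
        using \<open>\<forall>n\<ge>M. norm (X m - X n) < e\<close> that norm_hsum_ge0 by (intro power_mono) (auto simp: less_imp_le)
      finally show ?thesis .
    qed
    then show "\<exists>N. \<forall>n\<ge>N. (\<Sum>t\<in>F. (cmod (coord (X m) t - coord (X n) t))\<^sup>2) \<le> e\<^sup>2" by blast
  qed
  obtain M1 where M1: "\<forall>m\<ge>M1. \<forall>n\<ge>M1. norm (X m - X n) < 1" using C[of 1] by auto
  have "sqsum (\<lambda>t. coord (X M1) t - f t)"
    unfolding sqsum_def
  proof (rule nonneg_bdd_above_summable_on)
    show "bdd_above (sum (\<lambda>t. (cmod (coord (X M1) t - f t))\<^sup>2) ` {F. F \<subseteq> UNIV \<and> finite F})"
      using bound[of _ M1 M1 1] M1 by (intro bdd_aboveI2[of _ _ "1\<^sup>2"]) auto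
  qed auto
  then have "sqsum (\<lambda>t. coord (X M1) t + -1 * (coord (X M1) t - f t))"
    by (intro sqsum_add sqsum_coord sqsum_scale)
  then have "sqsum f" by simp
  moreover have "f t = 0" if "\<not> is_idx t" for t
  proof -
    have "coord (X n) t = 0" for n using coord[of "X n"] that by blast
    then have "(\<lambda>n. 0) \<longlonglongrightarrow> f t" using f[of t] by simp
    then show ?thesis using LIMSEQ_unique[OF tendsto_const] by metis
  qed
  ultimately have cL: "coord (Hsum f) = f" by (simp add: Hsum_inverse)
  have "\<exists>M. \<forall>n\<ge>M. norm (X n - Hsum f) \<le> e" if "e > 0" for e
  proof -
    obtain M where M: "\<forall>m\<ge>M. \<forall>n\<ge>M. norm (X m - X n) < e" using C \<open>e > 0\<close> by blast
    have "norm (X m - Hsum f) \<le> e" if "m \<ge> M" for m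
      using bound[of _ M m e] M that \<open>e > 0\<close>
      by (intro norm_hsum_le) (auto simp: minus_hsum.rep_eq cL)
    then show ?thesis by blast
  qed
  then show ?thesis by blast
qed

instance
proof
  fix x y z :: hsum and a b :: real
  show "x + y + z = x + (y + z)" by transfer (simp add: add.assoc)
  show "x + y = y + x" by transfer (simp add: add.commute)
  show "0 + x = x" by transfer simp
  show "- x + x = 0" by transfer simp
  show "x - y = x + - y" by transfer simp
  show "a *\<^sub>R (x + y) = a *\<^sub>R x + a *\<^sub>R y" by transfer (simp add: algebra_simps)
  show "(a + b) *\<^sub>R x = a *\<^sub>R x + b *\<^sub>R x" by transfer (simp add: algebra_simps)
  show "a *\<^sub>R b *\<^sub>R x = (a * b) *\<^sub>R x" by transfer (simp add: algebra_simps)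
  show "1 *\<^sub>R x = x" by transfer simp
  show "dist x y = norm (x - y)" by (rule dist_hsum_def)
  show "sgn x = inverse (norm x) *\<^sub>R x" by (rule sgn_hsum_def)
  show "(uniformity :: (hsum \<times> hsum) filter) = (INF e\<in>{0<..}. principal {(x, y). dist x y < e})"
    by (rule uniformity_hsum_def)
  show "open U \<longleftrightarrow> (\<forall>x\<in>U. \<forall>\<^sub>F (x', y) in uniformity. x' = x \<longrightarrow> y \<in> U)" for U :: "hsum set"
    by (rule open_hsum_def)
  show "inner x y = inner y x"
    unfolding inner_hsum_def using cinner_commute_hsum[of x y] by simp
  show "inner (x + y) z = inner x z + inner y z"
    unfolding inner_hsum_def by (simp add: cinner_add_left_hsum)
  show "inner (a *\<^sub>R x) y = a * inner x y"
    unfolding inner_hsum_def scaleC_of_real_hsum[symmetric] by (simp add: cinner_scaleC_left_hsum)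
  show "0 \<le> inner x x"
    unfolding inner_hsum_def cinner_hsum_self by (simp add: infsum_nonneg)
  show "norm x = sqrt (inner x x)" by (rule norm_hsum_def)
  show "inner x x = 0 \<longleftrightarrow> x = 0"
  proof
    assume "inner x x = 0"
    then have "norm x = 0" by (simp add: norm_hsum_def)
    then have "coord x t = 0" for t using coord_le_norm[of x t] by simp
    then show "x = 0" by transfer auto
  qed (simp add: inner_hsum_def cinner_hsum_self zero_hsum.rep_eq)
qed

end

instantiation hsum :: complex_hilbert
begin

definition scaleC_hsum :: "complex \<Rightarrow> hsum \<Rightarrow> hsum" where "scaleC_hsum = hscale"

definition cinner_hsum :: "hsum \<Rightarrow> hsum \<Rightarrow> complex" where "cinner_hsum = hinner"

instance
proof
  fix X :: "nat \<Rightarrow> hsum"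
  assume "Cauchy X"
  then have "\<exists>M. \<forall>m\<ge>M. \<forall>n\<ge>M. norm (X m - X n) < e" if "e > 0" for e
    using that unfolding Cauchy_def dist_hsum_def by blast
  from hsum_complete[OF this] obtain L where L: "\<forall>e>0. \<exists>M. \<forall>n\<ge>M. norm (X n - L) \<le> e"
    by blast
  have "X \<longlonglongrightarrow> L"
    unfolding lim_sequentially dist_hsum_def
  proof (intro allI impI)
    fix e :: real assume "e > 0"
    then obtain M where "\<forall>n\<ge>M. norm (X n - L) \<le> e / 2" using L half_gt_zero by blast
    then show "\<exists>no. \<forall>n\<ge>no. norm (X n - L) < e" using \<open>e > 0\<close> by (intro exI[of _ M]) force
  qed
  then show "convergent X" by (rule convergentI)
next
  fix x y z :: hsum and a :: real and c d :: complex
  show "c *\<^sub>C (x + y) = c *\<^sub>C x + c *\<^sub>C y" unfolding scaleC_hsum_def by transfer (simp add: algebra_simps)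
  show "(c + d) *\<^sub>C x = c *\<^sub>C x + d *\<^sub>C x" unfolding scaleC_hsum_def by transfer (simp add: algebra_simps)
  show "c *\<^sub>C d *\<^sub>C x = (c * d) *\<^sub>C x" unfolding scaleC_hsum_def by transfer (simp add: algebra_simps)
  show "complex_of_real a *\<^sub>C x = a *\<^sub>R x" unfolding scaleC_hsum_def by (rule scaleC_of_real_hsum)
  show "cinner x y = cnj (cinner y x)" unfolding scaleC_hsum_def cinner_hsum_def by (rule cinner_commute_hsum)
  show "cinner (x + y) z = cinner x z + cinner y z" unfolding scaleC_hsum_def cinner_hsum_def by (rule cinner_add_left_hsum)
  show "cinner (c *\<^sub>C x) y = c * cinner x y" unfolding scaleC_hsum_def cinner_hsum_def by (rule cinner_scaleC_left_hsum)
  show "inner x y = Re (cinner x y)" unfolding cinner_hsum_def by (rule inner_hsum_def)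
qed

end


section \<open>Tuples of matrices\<close>

text \<open>A tuple \<open>(x\<^sub>n)\<close> with \<open>x\<^sub>n \<in> M\<^sub>n\<close> for \<open>n = 1, 2, \<dots>\<close> is a function on \<open>nat\<close>; its value at \<open>0\<close> is
  the unique \<open>0 \<times> 0\<close> matrix and plays no role. Matrix entries and coordinates are counted from \<open>0\<close>.\<close>

type_synonym mtuple = "nat \<Rightarrow> complex mat"

definition tuples :: "mtuple set" where
  "tuples = {x. \<forall>n. x n \<in> carrier_mat n n}"

definition tzero :: mtuple where "tzero = (\<lambda>n. 0\<^sub>m n n)"
definition tadd :: "mtuple \<Rightarrow> mtuple \<Rightarrow> mtuple" where "tadd x y = (\<lambda>n. x n + y n)"
definition tminus :: "mtuple \<Rightarrow> mtuple \<Rightarrow> mtuple" where "tminus x y = (\<lambda>n. x n - y n)"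
definition tscale :: "complex \<Rightarrow> mtuple \<Rightarrow> mtuple" where "tscale a x = (\<lambda>n. a \<cdot>\<^sub>m x n)"
definition tmult :: "mtuple \<Rightarrow> mtuple \<Rightarrow> mtuple" where "tmult x y = (\<lambda>n. x n * y n)"

definition vnorm :: "complex vec \<Rightarrow> real" where
  "vnorm v = L2_set (\<lambda>i. cmod (vec_index v i)) {..<dim_vec v}"

definition opnorm :: "complex mat \<Rightarrow> real" where
  "opnorm X = Sup {vnorm (X *\<^sub>v v) |v. v \<in> carrier_vec (dim_col X) \<and> vnorm v \<le> 1}"


section \<open>The algebras \<open>N\<close>, \<open>A\<^sub>0\<close> and \<open>A\<close>\<close>

definition dmat :: "(nat \<Rightarrow> real) \<Rightarrow> nat \<Rightarrow> complex mat" where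
  "dmat c n = mat_diag n (\<lambda>i. complex_of_real (c n ^ Suc i))"

definition dmat_inv :: "(nat \<Rightarrow> real) \<Rightarrow> nat \<Rightarrow> complex mat" where
  "dmat_inv c n = mat_diag n (\<lambda>i. inverse (complex_of_real (c n ^ Suc i)))"

lemma dmat_inv_inverts:
  assumes "c n > 0"
  shows "dmat c n * dmat_inv c n = 1\<^sub>m n" "dmat_inv c n * dmat c n = 1\<^sub>m n"
proof -
  have "complex_of_real (c n ^ k) \<noteq> 0" for k using assms by simp
  then have "complex_of_real (c n ^ k) * inverse (complex_of_real (c n ^ k)) = 1"
    "inverse (complex_of_real (c n ^ k)) * complex_of_real (c n ^ k) = 1" for k
    by (rule right_inverse, rule left_inverse)
  then show "dmat c n * dmat_inv c n = 1\<^sub>m n" "dmat_inv c n * dmat c n = 1\<^sub>m n"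
    unfolding dmat_def dmat_inv_def mat_diag_diag by (simp_all only: mat_diag_one)
qed

definition dconj :: "(nat \<Rightarrow> real) \<Rightarrow> mtuple \<Rightarrow> mtuple" where
  "dconj c x = (\<lambda>n. dmat c n * x n * dmat_inv c n)"

definition linf_sum :: "mtuple set" where
  "linf_sum = {x \<in> tuples. bdd_above ((\<lambda>n. opnorm (x n)) ` {1..})}"

text \<open>\<open>x\<close> stands for the tuple \<open>((x\<^sub>n, d\<^sub>n x\<^sub>n d\<^sub>n\<^sup>-\<^sup>1))\<^sub>n\<close>, which lies in the \<open>\<ell>\<^sup>\<infinity>\<close>-direct sum \<open>M\<close> iff both
  of its component tuples are bounded.\<close>

definition algN :: "(nat \<Rightarrow> real) \<Rightarrow> mtuple set" where
  "algN c = {x \<in> linf_sum. dconj c x \<in> linf_sum}"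

definition pn :: "(nat \<Rightarrow> real) \<Rightarrow> nat \<Rightarrow> complex mat \<Rightarrow> real" where
  "pn c n X = max (opnorm X) (opnorm (dmat c n * X * dmat_inv c n))"

definition pnorm :: "(nat \<Rightarrow> real) \<Rightarrow> mtuple \<Rightarrow> real" where
  "pnorm c x = (SUP n\<in>{1..}. pn c n (x n))"

definition algA00 :: "(nat \<Rightarrow> real) \<Rightarrow> mtuple set" where
  "algA00 c = {x \<in> algN c. finite {n. x n \<noteq> 0\<^sub>m n n}}"

definition algA0 :: "(nat \<Rightarrow> real) \<Rightarrow> mtuple set" where
  "algA0 c = {x \<in> algN c. \<forall>e>0. \<exists>y\<in>algA00 c. pnorm c (tminus x y) < e}"

definition lshift :: "nat \<Rightarrow> complex mat" where
  "lshift n = Matrix.mat n n (\<lambda>(i, j). if j = Suc i then 1 else 0)"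

definition Eset :: "nat \<Rightarrow> nat \<Rightarrow> nat set" where
  "Eset n k = {i. real n / real k \<le> real i \<and> real i \<le> 2 * real n / real k}"

text \<open>The average of the powers of the shift is written entrywise, since the library has no
  big-operator sum on matrices of a fixed size.\<close>

definition ublock :: "nat \<Rightarrow> nat \<Rightarrow> complex mat" where
  "ublock n k =
     (if n < k then 1\<^sub>m n
      else Matrix.mat n n (\<lambda>(r, s). (1 / of_nat (card (Eset n k))) * (\<Sum>i\<in>Eset n k. (lshift n ^\<^sub>m i) $$ (r, s))))"

definition useq :: "nat \<Rightarrow> mtuple" where
  "useq k = (\<lambda>n. ublock n k)"

definition algA :: "(nat \<Rightarrow> real) \<Rightarrow> mtuple set" where
  "algA c = {a \<in> algN c.
     (\<lambda>k. pnorm c (tminus (tmult a (useq k)) a) + pnorm c (tminus (tmult (useq k) a) a)) \<longlonglongrightarrow> 0}"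


section \<open>Algebraic notions for algebras of tuples\<close>

definition subalgebra :: "mtuple set \<Rightarrow> bool" where
  "subalgebra A \<longleftrightarrow> A \<subseteq> tuples \<and> tzero \<in> A \<and> (\<forall>x\<in>A. \<forall>y\<in>A. tadd x y \<in> A) \<and>
     (\<forall>a. \<forall>x\<in>A. tscale a x \<in> A) \<and> (\<forall>x\<in>A. \<forall>y\<in>A. tmult x y \<in> A)"

definition left_ideal :: "mtuple set \<Rightarrow> mtuple set \<Rightarrow> bool" where
  "left_ideal A J \<longleftrightarrow> J \<subseteq> A \<and> tzero \<in> J \<and> (\<forall>x\<in>J. \<forall>y\<in>J. tadd x y \<in> J) \<and>
     (\<forall>a. \<forall>x\<in>J. tscale a x \<in> J) \<and> (\<forall>a\<in>A. \<forall>x\<in>J. tmult a x \<in> J)"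

definition two_sided_ideal :: "mtuple set \<Rightarrow> mtuple set \<Rightarrow> bool" where
  "two_sided_ideal A J \<longleftrightarrow> left_ideal A J \<and> (\<forall>a\<in>A. \<forall>x\<in>J. tmult x a \<in> J)"

definition modular_left_ideal :: "mtuple set \<Rightarrow> mtuple set \<Rightarrow> bool" where
  "modular_left_ideal A J \<longleftrightarrow> left_ideal A J \<and> (\<exists>e\<in>A. \<forall>a\<in>A. tminus a (tmult a e) \<in> J)"

definition maximal_modular_left_ideal :: "mtuple set \<Rightarrow> mtuple set \<Rightarrow> bool" where
  "maximal_modular_left_ideal A J \<longleftrightarrow> modular_left_ideal A J \<and> J \<noteq> A \<and>
     (\<forall>K. left_ideal A K \<and> J \<subseteq> K \<and> K \<noteq> A \<longrightarrow> K = J)"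

text \<open>The algebras need not be unital, so the Jacobson radical is the intersection of the maximal
  modular left ideals (the whole algebra if there are none).\<close>

definition jacobson_radical :: "mtuple set \<Rightarrow> mtuple set" where
  "jacobson_radical A = {x \<in> A. \<forall>J. maximal_modular_left_ideal A J \<longrightarrow> x \<in> J}"

definition semisimple :: "mtuple set \<Rightarrow> bool" where
  "semisimple A \<longleftrightarrow> jacobson_radical A = {tzero}"

text \<open>The sequence is indexed by \<open>k = 1, 2, \<dots>\<close>.\<close>

definition contractive_approx_identity ::
    "(mtuple \<Rightarrow> real) \<Rightarrow> mtuple set \<Rightarrow> (nat \<Rightarrow> mtuple) \<Rightarrow> bool" where
  "contractive_approx_identity p A e \<longleftrightarrow>
     (\<forall>k\<ge>1. e k \<in> A \<and> p (e k) \<le> 1) \<and>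
     (\<forall>a\<in>A. (\<lambda>k. p (tminus (tmult a (e k)) a)) \<longlonglongrightarrow> 0 \<and>
            (\<lambda>k. p (tminus (tmult (e k) a) a)) \<longlonglongrightarrow> 0)"


section \<open>Tuples as operators on the Hilbert space\<close>

text \<open>The element \<open>((x\<^sub>n, d\<^sub>n x\<^sub>n d\<^sub>n\<^sup>-\<^sup>1))\<^sub>n\<close> of \<open>M\<close> acts as the block diagonal operator with these blocks.\<close>

definition block_op :: "(nat \<Rightarrow> real) \<Rightarrow> mtuple \<Rightarrow> hsum \<Rightarrow>\<^sub>L hsum" where
  "block_op c x = Blinfun (\<lambda>f. Hsum (\<lambda>(n, b, i).
     if i < n then (\<Sum>j<n. (if b then dconj c x n else x n) $$ (i, j) * coord f (n, b, j)) else 0))"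

text \<open>An algebra \<open>A\<close> of tuples with norm \<open>p\<close> is an operator algebra via \<open>\<pi>\<close> if \<open>\<pi>\<close> identifies it,
  isometrically and as an algebra, with a norm-closed subalgebra of \<open>B(H)\<close>.\<close>

definition operator_algebra_via ::
    "(mtuple \<Rightarrow> 'h::complex_hilbert \<Rightarrow>\<^sub>L 'h) \<Rightarrow> (mtuple \<Rightarrow> real) \<Rightarrow> mtuple set \<Rightarrow> bool" where
  "operator_algebra_via \<pi> p A \<longleftrightarrow>
     subalgebra A \<and>
     (\<forall>x\<in>A. \<forall>y\<in>A. \<pi> (tadd x y) = \<pi> x + \<pi> y) \<and>
     (\<forall>a. \<forall>x\<in>A. \<pi> (tscale a x) = scale_op a (\<pi> x)) \<and>
     (\<forall>x\<in>A. \<forall>y\<in>A. \<pi> (tmult x y) = \<pi> x o\<^sub>L \<pi> y) \<and>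
     (\<forall>x\<in>A. norm (\<pi> x) = p x) \<and>
     operator_algebra (\<pi> ` A)"

end

theory Submission
  imports Defs
begin

text \<open>A tuple acts on the Hilbert space block by block, so \<open>p\<close> is the operator norm of the represented
  tuple and \<open>N\<close> becomes a norm-closed algebra of operators. Conjugation by \<open>d\<^sub>n\<close> turns \<open>L\<^sub>n\<close> into
  \<open>c\<^sub>n\<^sup>-\<^sup>1 L\<^sub>n\<close> with \<open>c\<^sub>n > 1\<close>, so the \<open>p\<close>-norm of a polynomial in the shifts is at most the \<open>\<ell>\<^sup>1\<close>-norm of its
  coefficients. The coefficients of \<open>u\<^bsub>n,m\<^esub>\<close> are uniform on an interval of length \<open>n/m\<close>, and
  multiplying by \<open>u\<^bsub>n,k\<^esub>\<close> averages translates of it by at most \<open>2n/k\<close>; hence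
  \<open>p(u\<^sub>k u\<^sub>m - u\<^sub>m) \<le> 8m/k\<close> and \<open>u\<^sub>m \<in> A\<close>. Finitely supported tuples lie in \<open>A\<close> because
  \<open>u\<^bsub>n,k\<^esub> = I\<close> for \<open>k > n\<close>. Therefore \<open>A\<close> maps onto every \<open>M\<^sub>n\<close>, and the annihilators in \<open>A\<close> of
  single vectors of \<open>\<complex>\<^sup>n\<close> are maximal modular left ideals with zero intersection.\<close>

section \<open>Operator norms of matrices\<close>

lemma mult_mat_vec_nth:
  assumes "A \<in> carrier_mat m n" "v \<in> carrier_vec n" "i < m"
  shows "vec_index (A *\<^sub>v v) i = (\<Sum>j<n. A $$ (i, j) * vec_index v j)"
  using assms by (auto simp: scalar_prod_def atLeast0LessThan intro!: sum.cong)

lemma vnorm_nonneg [simp]: "0 \<le> vnorm v"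
  by (simp add: vnorm_def L2_set_nonneg)

lemma vnorm_zero [simp]: "vnorm (0\<^sub>v n) = 0"
  by (simp add: vnorm_def L2_set_def)

lemma zero_mat_mult_vec: "v \<in> carrier_vec n \<Longrightarrow> 0\<^sub>m m n *\<^sub>v v = (0\<^sub>v m :: complex vec)"
  by (intro eq_vecI) auto

lemma smult_mat_mult_vec:
  assumes "X \<in> carrier_mat m n" "v \<in> carrier_vec n"
  shows "(a \<cdot>\<^sub>m X) *\<^sub>v v = a \<cdot>\<^sub>v (X *\<^sub>v (v :: complex vec))"
proof (rule eq_vecI)
  fix i assume "i < dim_vec (a \<cdot>\<^sub>v (X *\<^sub>v v))"
  then show "vec_index ((a \<cdot>\<^sub>m X) *\<^sub>v v) i = vec_index (a \<cdot>\<^sub>v (X *\<^sub>v v)) i"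
    using assms mult_mat_vec_nth[of "a \<cdot>\<^sub>m X" m n v i] mult_mat_vec_nth[of X m n v i]
    by (simp add: sum_distrib_left mult.assoc)
qed (use assms in auto)

lemma vnorm_smult: "vnorm (a \<cdot>\<^sub>v v) = cmod a * vnorm v"
proof -
  have "vnorm (a \<cdot>\<^sub>v v) = L2_set (\<lambda>i. cmod a * cmod (vec_index v i)) {..<dim_vec v}"
    unfolding vnorm_def by (intro L2_set_cong) (auto simp: norm_mult)
  then show ?thesis by (simp add: vnorm_def L2_set_right_distrib)
qed

lemma vnorm_triangle:
  assumes "v \<in> carrier_vec n" "w \<in> carrier_vec n"
  shows "vnorm (v + w) \<le> vnorm v + vnorm w"
proof -
  have "vnorm (v + w) \<le> L2_set (\<lambda>i. cmod (vec_index v i) + cmod (vec_index w i)) {..<n}"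
    unfolding vnorm_def using assms by (auto intro!: L2_set_mono norm_triangle_ineq)
  also have "\<dots> \<le> vnorm v + vnorm w"
    using assms L2_set_triangle_ineq by (auto simp: vnorm_def)
  finally show ?thesis .
qed

lemma entry_le_vnorm:
  assumes "i < dim_vec v"
  shows "cmod (vec_index v i) \<le> vnorm v"
  using assms unfolding vnorm_def
  by (intro member_le_L2_set) auto

text \<open>A crude entrywise estimate: it shows that the supremum defining \<open>opnorm\<close> is
  finite, and it settles vectors of norm zero, which cannot be normalised.\<close>

lemma mult_mat_vec_bounded:
  assumes X: "X \<in> carrier_mat m n" and v: "v \<in> carrier_vec n"
  shows "vnorm (X *\<^sub>v v) \<le> (\<Sum>i<m. \<Sum>j<n. cmod (X $$ (i, j))) * vnorm v"
proof -
  have "vnorm (X *\<^sub>v v) \<le> (\<Sum>i<m. cmod (vec_index (X *\<^sub>v v) i))"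
    unfolding vnorm_def using X by (intro order_trans[OF L2_set_le_sum]) auto
  also have "\<dots> \<le> (\<Sum>i<m. \<Sum>j<n. cmod (X $$ (i, j)) * vnorm v)"
  proof (rule sum_mono)
    fix i assume "i \<in> {..<m}"
    then have "cmod (vec_index (X *\<^sub>v v) i) \<le> (\<Sum>j<n. cmod (X $$ (i, j) * vec_index v j))"
      using mult_mat_vec_nth[OF X v] by (simp add: norm_sum)
    also have "\<dots> \<le> (\<Sum>j<n. cmod (X $$ (i, j)) * vnorm v)"
      using v by (intro sum_mono) (auto simp: norm_mult intro!: mult_left_mono entry_le_vnorm)
    finally show "cmod (vec_index (X *\<^sub>v v) i) \<le> (\<Sum>j<n. cmod (X $$ (i, j)) * vnorm v)" .
  qed
  finally show ?thesis by (simp add: sum_distrib_right)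
qed

section \<open>Basic properties of the operator norm\<close>

lemma opnorm_set_bdd:
  "bdd_above {vnorm (X *\<^sub>v v) |v. v \<in> carrier_vec (dim_col X) \<and> vnorm v \<le> 1}"
proof (rule bdd_aboveI)
  fix r assume "r \<in> {vnorm (X *\<^sub>v v) |v. v \<in> carrier_vec (dim_col X) \<and> vnorm v \<le> 1}"
  then obtain v where v: "v \<in> carrier_vec (dim_col X)" "vnorm v \<le> 1" "r = vnorm (X *\<^sub>v v)" by auto
  let ?C = "\<Sum>i<dim_row X. \<Sum>j<dim_col X. cmod (X $$ (i, j))"
  have "r \<le> ?C * vnorm v"
    unfolding v(3) by (rule mult_mat_vec_bounded) (use v in auto)
  also have "\<dots> \<le> ?C * 1" using v(2) by (intro mult_left_mono) (auto intro!: sum_nonneg)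
  finally show "r \<le> ?C * 1" .
qed

lemma opnorm_nonneg [simp]: "0 \<le> opnorm X"
proof -
  have "vnorm (X *\<^sub>v 0\<^sub>v (dim_col X)) \<le> opnorm X"
    unfolding opnorm_def by (rule cSup_upper[OF _ opnorm_set_bdd]) (force)
  then show ?thesis using vnorm_nonneg order_trans by blast
qed

lemma vnorm_mult_le:
  assumes X: "X \<in> carrier_mat m n" and v: "v \<in> carrier_vec n"
  shows "vnorm (X *\<^sub>v v) \<le> opnorm X * vnorm v"
proof (cases "vnorm v = 0")
  case True
  then show ?thesis using mult_mat_vec_bounded[OF X v] by simp
next
  case False
  then have pos: "vnorm v > 0" by (simp add: less_le)
  \<comment> \<open>The factor that scales \<open>v\<close> into the unit ball over which the
    supremum is taken.\<close>
  define a where "a = complex_of_real (1 / vnorm v)"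
  have a: "cmod a = 1 / vnorm v" using pos by (simp add: a_def norm_divide)
  have "vnorm (X *\<^sub>v (a \<cdot>\<^sub>v v)) \<le> opnorm X"
    unfolding opnorm_def
  proof (rule cSup_upper[OF _ opnorm_set_bdd])
    have "vnorm (a \<cdot>\<^sub>v v) \<le> 1" using pos by (simp add: vnorm_smult a)
    then show "vnorm (X *\<^sub>v (a \<cdot>\<^sub>v v)) \<in> {vnorm (X *\<^sub>v v) |v. v \<in> carrier_vec (dim_col X) \<and> vnorm v \<le> 1}"
      using X v by auto
  qed
  moreover have "X *\<^sub>v (a \<cdot>\<^sub>v v) = a \<cdot>\<^sub>v (X *\<^sub>v v)"
    using X v by (simp add: mult_mat_vec)
  ultimately show ?thesis using pos by (simp add: vnorm_smult a field_simps)
qed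

lemma opnorm_le:
  assumes X: "X \<in> carrier_mat m n" and "0 \<le> B"
    and le: "\<And>v. v \<in> carrier_vec n \<Longrightarrow> vnorm (X *\<^sub>v v) \<le> B * vnorm v"
  shows "opnorm X \<le> B"
  unfolding opnorm_def
proof (rule cSup_least)
  show "{vnorm (X *\<^sub>v v) |v. v \<in> carrier_vec (dim_col X) \<and> vnorm v \<le> 1} \<noteq> {}"
    by (auto intro!: exI[of _ "0\<^sub>v (dim_col X)"])
  fix r assume "r \<in> {vnorm (X *\<^sub>v v) |v. v \<in> carrier_vec (dim_col X) \<and> vnorm v \<le> 1}"
  then obtain v where v: "v \<in> carrier_vec n" "vnorm v \<le> 1" "r = vnorm (X *\<^sub>v v)" using X by auto
  then have "r \<le> B * vnorm v" using le by simp
  also have "\<dots> \<le> B * 1" using v \<open>0 \<le> B\<close> by (intro mult_left_mono) auto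
  finally show "r \<le> B" by simp
qed

lemma opnorm_add:
  assumes X: "X \<in> carrier_mat m n" and Y: "Y \<in> carrier_mat m n"
  shows "opnorm (X + Y) \<le> opnorm X + opnorm Y"
proof (rule opnorm_le)
  fix v :: "complex vec" assume v: "v \<in> carrier_vec n"
  have "vnorm ((X + Y) *\<^sub>v v) = vnorm (X *\<^sub>v v + Y *\<^sub>v v)"
    using X Y v by (simp add: add_mult_distrib_mat_vec)
  also have "\<dots> \<le> vnorm (X *\<^sub>v v) + vnorm (Y *\<^sub>v v)"
    using X Y v by (intro vnorm_triangle[of _ m]) auto
  also have "\<dots> \<le> (opnorm X + opnorm Y) * vnorm v"
    using vnorm_mult_le[OF X v] vnorm_mult_le[OF Y v] by (simp add: distrib_right)
  finally show "vnorm ((X + Y) *\<^sub>v v) \<le> (opnorm X + opnorm Y) * vnorm v" .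
qed (use X Y in auto)

lemma opnorm_mult:
  assumes X: "X \<in> carrier_mat l m" and Y: "Y \<in> carrier_mat m n"
  shows "opnorm (X * Y) \<le> opnorm X * opnorm Y"
proof (rule opnorm_le)
  fix v :: "complex vec" assume v: "v \<in> carrier_vec n"
  have "vnorm ((X * Y) *\<^sub>v v) = vnorm (X *\<^sub>v (Y *\<^sub>v v))"
    using X Y v by simp
  also have "\<dots> \<le> opnorm X * vnorm (Y *\<^sub>v v)"
    using X Y v by (intro vnorm_mult_le) auto
  also have "\<dots> \<le> opnorm X * (opnorm Y * vnorm v)"
    using vnorm_mult_le[OF Y v] by (intro mult_left_mono) auto
  finally show "vnorm ((X * Y) *\<^sub>v v) \<le> (opnorm X * opnorm Y) * vnorm v" by (simp add: mult.assoc)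
qed (use X Y in auto)

lemma opnorm_smult_le:
  assumes X: "X \<in> carrier_mat m n"
  shows "opnorm (a \<cdot>\<^sub>m X) \<le> cmod a * opnorm X"
proof (rule opnorm_le)
  fix v :: "complex vec" assume v: "v \<in> carrier_vec n"
  show "vnorm ((a \<cdot>\<^sub>m X) *\<^sub>v v) \<le> (cmod a * opnorm X) * vnorm v"
    using vnorm_mult_le[OF X v]
    by (auto simp: smult_mat_mult_vec[OF X v] vnorm_smult mult.assoc intro!: mult_left_mono)
qed (use X in auto)

text \<open>An entry is a coordinate of the image of a unit vector. Hence norm-Cauchy sequences of
  matrices are entrywise Cauchy.\<close>

lemma entry_le_opnorm:
  assumes X: "X \<in> carrier_mat m n" and ij: "i < m" "j < n"
  shows "cmod (X $$ (i, j)) \<le> opnorm X"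
proof -
  have "vnorm (unit_vec n j :: complex vec) = L2_set (\<lambda>i. if i = j then 1 else 0) {..<n}"
    unfolding vnorm_def using ij by (intro L2_set_cong) (auto simp: unit_vec_def)
  also have "\<dots> = 1" using ij by (simp add: L2_set_def if_distrib[of "\<lambda>x. x\<^sup>2"] cong: if_cong)
  finally have 1: "vnorm (unit_vec n j :: complex vec) = 1" .
  have "X *\<^sub>v unit_vec n j = col X j"
    using X ij by (intro eq_vecI) (auto simp: scalar_prod_right_unit)
  then have "cmod (X $$ (i, j)) \<le> vnorm (X *\<^sub>v unit_vec n j)"
    using entry_le_vnorm[of i "col X j"] X ij by simp
  also have "\<dots> \<le> opnorm X * 1" unfolding 1[symmetric] by (rule vnorm_mult_le[OF X]) auto
  finally show ?thesis by simp
qed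

text \<open>For a fixed vector, the norm of its image depends continuously on the finitely many
  entries, so the operator norm is lower semicontinuous under entrywise convergence.\<close>

lemma opnorm_le_limit:
  assumes X: "\<And>l. X l \<in> carrier_mat m n" and Y: "Y \<in> carrier_mat m n"
    and lim: "\<And>i j. i < m \<Longrightarrow> j < n \<Longrightarrow> (\<lambda>l. X l $$ (i, j)) \<longlonglongrightarrow> Y $$ (i, j)"
    and le: "\<forall>\<^sub>F l in sequentially. opnorm (X l) \<le> B"
  shows "opnorm Y \<le> B"
proof -
  obtain l where "opnorm (X l) \<le> B" using eventually_happens[OF le] by auto
  then have B: "0 \<le> B" using opnorm_nonneg order_trans by blast
  show ?thesis
  proof (rule opnorm_le[OF Y B])
    fix v :: "complex vec" assume v: "v \<in> carrier_vec n"
    have vn: "vnorm (Z *\<^sub>v v) = L2_set (\<lambda>i. cmod (\<Sum>j<n. Z $$ (i, j) * vec_index v j)) {..<m}"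
      if "Z \<in> carrier_mat m n" for Z
      unfolding vnorm_def using that mult_mat_vec_nth[OF that v] by (intro L2_set_cong) auto
    have "(\<lambda>l. vnorm (X l *\<^sub>v v)) \<longlonglongrightarrow> vnorm (Y *\<^sub>v v)"
      unfolding vn[OF X] vn[OF Y] L2_set_def by (intro tendsto_intros lim) auto
    moreover have "\<forall>\<^sub>F l in sequentially. vnorm (X l *\<^sub>v v) \<le> B * vnorm v"
      using le
    proof eventually_elim
      case (elim l)
      have "vnorm (X l *\<^sub>v v) \<le> opnorm (X l) * vnorm v" by (rule vnorm_mult_le[OF X v])
      also have "\<dots> \<le> B * vnorm v" using elim by (intro mult_right_mono) auto
      finally show ?case .
    qed
    ultimately show "vnorm (Y *\<^sub>v v) \<le> B * vnorm v"
      by (intro tendsto_upperbound) auto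
  qed
qed

section \<open>The norm on \<open>N\<close>\<close>

text \<open>The flag \<open>b\<close> matches the one in the index triples of \<open>hsum\<close>,
  so that both components of a tuple are handled by one argument.\<close>

definition block :: "(nat \<Rightarrow> real) \<Rightarrow> mtuple \<Rightarrow> nat \<Rightarrow> bool \<Rightarrow> complex mat" where
  "block c x n b = (if b then dconj c x n else x n)"

lemma dmat_carrier [simp]: "dmat c n \<in> carrier_mat n n" "dmat_inv c n \<in> carrier_mat n n"
  by (auto simp: dmat_def dmat_inv_def mat_diag_def)

lemma tuplesD: "x \<in> tuples \<Longrightarrow> x n \<in> carrier_mat n n"
  by (simp add: tuples_def)

lemma block_carrier: "x \<in> tuples \<Longrightarrow> block c x n b \<in> carrier_mat n n"
  by (auto simp: block_def dconj_def tuples_def intro!: mult_carrier_mat[of _ n n])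

lemma tuples_ops [simp]:
  "tzero \<in> tuples"
  "x \<in> tuples \<Longrightarrow> y \<in> tuples \<Longrightarrow> tadd x y \<in> tuples"
  "x \<in> tuples \<Longrightarrow> y \<in> tuples \<Longrightarrow> tminus x y \<in> tuples"
  "x \<in> tuples \<Longrightarrow> tscale a x \<in> tuples"
  "x \<in> tuples \<Longrightarrow> y \<in> tuples \<Longrightarrow> tmult x y \<in> tuples"
  by (simp_all add: tuples_def tzero_def tadd_def tminus_def tscale_def tmult_def
      minus_carrier_mat mult_carrier_mat[of _ n n for n])

lemma tminus_eq: "x \<in> tuples \<Longrightarrow> y \<in> tuples \<Longrightarrow> tminus x y = tadd x (tscale (-1) y)"
  unfolding tuples_def tminus_def tadd_def tscale_def by (fastforce intro!: eq_matI)

text \<open>Conjugation by a diagonal matrix multiplies each entry by a fixed scalar. Linearity and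
  limits can therefore be checked entry by entry in both components.\<close>

lemma block_nth:
  assumes "x \<in> tuples" "i < n" "j < n"
  shows "block c x n b $$ (i, j) =
    (if b then complex_of_real (c n ^ Suc i) * x n $$ (i, j) * inverse (complex_of_real (c n ^ Suc j))
     else x n $$ (i, j))"
  using tuplesD[OF assms(1), of n] assms(2,3)
  by (auto simp: block_def dconj_def dmat_def dmat_inv_def mat_diag_mult_left[of _ n n] mat_diag_mult_right[of _ n n])

lemma block_tadd:
  assumes "x \<in> tuples" "y \<in> tuples"
  shows "block c (tadd x y) n b = block c x n b + block c y n b"
proof (rule eq_matI)
  have tadd: "tadd x y n $$ (i, j) = x n $$ (i, j) + y n $$ (i, j)" if "i < n" "j < n" for i j
    using tuplesD[OF assms(2), of n] that by (simp add: tadd_def)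
  fix i j assume "i < dim_row (block c x n b + block c y n b)" "j < dim_col (block c x n b + block c y n b)"
  then have ij: "i < n" "j < n" using block_carrier[OF assms(2), of c n b] by auto
  then show "block c (tadd x y) n b $$ (i, j) = (block c x n b + block c y n b) $$ (i, j)"
    using assms tadd[OF ij] block_carrier[OF assms(2), of c n b]
    by (cases b) (auto simp: block_nth distrib_left distrib_right)
qed (use block_carrier[of "tadd x y" c n b] block_carrier[OF assms(2), of c n b] assms in auto)

lemma block_tscale:
  assumes "x \<in> tuples"
  shows "block c (tscale a x) n b = a \<cdot>\<^sub>m block c x n b"
proof (rule eq_matI)
  have tscale: "tscale a x n $$ (i, j) = a * x n $$ (i, j)" if "i < n" "j < n" for i j
    using tuplesD[OF assms, of n] that by (simp add: tscale_def)
  fix i j assume "i < dim_row (a \<cdot>\<^sub>m block c x n b)" "j < dim_col (a \<cdot>\<^sub>m block c x n b)"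
  then have ij: "i < n" "j < n" using block_carrier[OF assms, of c n b] by auto
  then show "block c (tscale a x) n b $$ (i, j) = (a \<cdot>\<^sub>m block c x n b) $$ (i, j)"
    using assms tscale[OF ij] block_carrier[OF assms, of c n b]
    by (cases b) (auto simp: block_nth)
qed (use block_carrier[of "tscale a x" c n b] block_carrier[OF assms, of c n b] assms in auto)

lemma block_tzero: "block c tzero n b = 0\<^sub>m n n"
proof -
  have "dmat c n * 0\<^sub>m n n * dmat_inv c n = 0\<^sub>m n n"
    using dmat_carrier[of c n] by (metis left_mult_zero_mat right_mult_zero_mat)
  then show ?thesis by (simp add: block_def dconj_def tzero_def)
qed

text \<open>Conjugation is multiplicative because the inner factors \<open>dmat_inv c n\<close> and
  \<open>dmat c n\<close> cancel. At \<open>n = 0\<close>, where nothing is known about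
  \<open>c\<close>, all matrices are empty.\<close>

lemma block_tmult:
  assumes c: "\<forall>n\<ge>1. c n > 1" and x: "x \<in> tuples" and y: "y \<in> tuples"
  shows "block c (tmult x y) n b = block c x n b * block c y n b"
proof (cases "n = 0")
  case True
  then show ?thesis
    using block_carrier[of "tmult x y" c n b] block_carrier[OF x, of c n b] block_carrier[OF y, of c n b] x y
    by (intro eq_matI) auto
next
  case False
  then have "1 < c n" using c by simp
  then have cn: "0 < c n" by linarith
  note D = dmat_carrier(1)[of c n] and I = dmat_carrier(2)[of c n]
  note X = tuplesD[OF x, of n] and Y = tuplesD[OF y, of n]
  have "dmat c n * x n * dmat_inv c n * (dmat c n * y n * dmat_inv c n)
      = dmat c n * x n * (dmat_inv c n * (dmat c n * (y n * dmat_inv c n)))"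
    using D I X Y by (simp add: assoc_mult_mat[of _ n n _ n _ n] mult_carrier_mat[of _ n n _ n])
  also have "dmat_inv c n * (dmat c n * (y n * dmat_inv c n)) = y n * dmat_inv c n"
    using D I Y by (simp add: assoc_mult_mat[of _ n n _ n _ n, symmetric] mult_carrier_mat[of _ n n _ n] dmat_inv_inverts(2)[of c n, OF cn])
  also have "dmat c n * x n * (y n * dmat_inv c n) = dmat c n * (x n * y n) * dmat_inv c n"
    using D I X Y by (simp add: assoc_mult_mat[of _ n n _ n _ n] mult_carrier_mat[of _ n n _ n])
  finally show ?thesis by (simp add: block_def dconj_def tmult_def)
qed

lemma pn_eq: "pn c n (x n) = max (opnorm (block c x n False)) (opnorm (block c x n True))"
  by (simp add: pn_def block_def dconj_def)

lemma pn_le_iff: "pn c n (x n) \<le> B \<longleftrightarrow> (\<forall>b. opnorm (block c x n b) \<le> B)"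
  unfolding pn_eq by (metis (full_types) max.bounded_iff)

text \<open>The two suprema required by \<open>linf_sum\<close> merge into a single constant, so
  membership in \<open>N\<close> is shown by exhibiting one bound for all blocks.\<close>

lemma algN_iff: "x \<in> algN c \<longleftrightarrow> x \<in> tuples \<and> (\<exists>B. \<forall>n\<ge>1. pn c n (x n) \<le> B)"
proof -
  have 1: "x \<in> tuples \<Longrightarrow> dconj c x \<in> tuples"
    using block_carrier[of x c _ True] by (auto simp: block_def tuples_def)
  show ?thesis
  proof
    assume "x \<in> algN c"
    then obtain B C where "x \<in> tuples" "\<And>n. n \<ge> 1 \<Longrightarrow> opnorm (x n) \<le> B" "\<And>n. n \<ge> 1 \<Longrightarrow> opnorm (dconj c x n) \<le> C"
      unfolding algN_def linf_sum_def bdd_above_def by auto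
    then show "x \<in> tuples \<and> (\<exists>B. \<forall>n\<ge>1. pn c n (x n) \<le> B)"
      by (intro conjI exI[of _ "max B C"]) (auto simp: pn_def dconj_def intro: max.mono le_max_iff_disj[THEN iffD2])
  next
    assume "x \<in> tuples \<and> (\<exists>B. \<forall>n\<ge>1. pn c n (x n) \<le> B)"
    then obtain B where "x \<in> tuples" "\<And>n. n \<ge> 1 \<Longrightarrow> pn c n (x n) \<le> B" by auto
    then show "x \<in> algN c"
      using 1 unfolding algN_def linf_sum_def
      by (auto simp: pn_def dconj_def intro!: bdd_aboveI2[of _ _ B])
  qed
qed

lemma algN_tuples: "x \<in> algN c \<Longrightarrow> x \<in> tuples"
  by (simp add: algN_iff)

lemma opnorm_block_le_pnorm:
  assumes "x \<in> algN c" "n \<ge> 1"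
  shows "opnorm (block c x n b) \<le> pnorm c x"
proof -
  obtain B where "\<forall>n\<ge>1. pn c n (x n) \<le> B" using assms algN_iff by blast
  then have "pn c n (x n) \<le> pnorm c x"
    unfolding pnorm_def using assms by (intro cSUP_upper) (auto intro!: bdd_aboveI2[of _ _ B])
  then show ?thesis unfolding pn_le_iff by blast
qed

lemma pnorm_le:
  assumes "\<And>n b. n \<ge> 1 \<Longrightarrow> opnorm (block c x n b) \<le> B"
  shows "pnorm c x \<le> B"
  unfolding pnorm_def using assms by (intro cSUP_least) (auto simp: pn_le_iff)

lemma algNI:
  assumes "x \<in> tuples" "\<And>n b. n \<ge> 1 \<Longrightarrow> opnorm (block c x n b) \<le> B"
  shows "x \<in> algN c"
  using assms unfolding algN_iff pn_le_iff by blast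

lemma pnorm_nonneg:
  assumes "x \<in> algN c"
  shows "0 \<le> pnorm c x"
  using opnorm_block_le_pnorm[OF assms, of 1 True] opnorm_nonneg order_trans by blast

section \<open>Closure of \<open>N\<close> under the algebra operations\<close>

lemma tzero_algN: "tzero \<in> algN c"
proof (rule algNI)
  fix n b
  show "opnorm (block c tzero n b) \<le> 0"
    by (rule opnorm_le[of _ n n]) (auto simp: block_tzero zero_mat_mult_vec)
qed simp

lemma tadd_algN:
  assumes "x \<in> algN c" "y \<in> algN c"
  shows "tadd x y \<in> algN c"
proof (rule algNI)
  note t = algN_tuples[OF assms(1)] algN_tuples[OF assms(2)]
  show "tadd x y \<in> tuples" using t by simp
  fix n :: nat and b assume n: "n \<ge> 1"
  have "opnorm (block c (tadd x y) n b) \<le> opnorm (block c x n b) + opnorm (block c y n b)"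
    unfolding block_tadd[OF t] by (intro opnorm_add[of _ n n] block_carrier t)
  then show "opnorm (block c (tadd x y) n b) \<le> pnorm c x + pnorm c y"
    using opnorm_block_le_pnorm[OF assms(1) n, of b] opnorm_block_le_pnorm[OF assms(2) n, of b] by linarith
qed

lemma tscale_algN:
  assumes "x \<in> algN c"
  shows "tscale a x \<in> algN c"
proof (rule algNI)
  note t = algN_tuples[OF assms(1)]
  show "tscale a x \<in> tuples" using t by simp
  fix n :: nat and b assume n: "n \<ge> 1"
  have "opnorm (block c (tscale a x) n b) \<le> cmod a * opnorm (block c x n b)"
    unfolding block_tscale[OF t] by (rule opnorm_smult_le[OF block_carrier[OF t]])
  also have "\<dots> \<le> cmod a * pnorm c x"
    using opnorm_block_le_pnorm[OF assms(1) n, of b] by (intro mult_left_mono) auto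
  finally show "opnorm (block c (tscale a x) n b) \<le> cmod a * pnorm c x" .
qed

lemma tminus_algN:
  assumes "x \<in> algN c" "y \<in> algN c"
  shows "tminus x y \<in> algN c"
  using assms by (simp add: tminus_eq algN_tuples tadd_algN tscale_algN)

lemma tmult_algN:
  assumes c: "\<forall>n\<ge>1. c n > 1" and "x \<in> algN c" "y \<in> algN c"
  shows "tmult x y \<in> algN c"
proof (rule algNI)
  note t = algN_tuples[OF assms(2)] algN_tuples[OF assms(3)]
  show "tmult x y \<in> tuples" using t by simp
  fix n :: nat and b assume n: "n \<ge> 1"
  have "opnorm (block c (tmult x y) n b) \<le> opnorm (block c x n b) * opnorm (block c y n b)"
    unfolding block_tmult[OF c t] by (intro opnorm_mult[of _ n n _ n] block_carrier t)
  also have "\<dots> \<le> pnorm c x * pnorm c y"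
    using opnorm_block_le_pnorm[OF assms(2) n, of b] opnorm_block_le_pnorm[OF assms(3) n, of b]
    by (intro mult_mono) (auto simp: pnorm_nonneg assms)
  finally show "opnorm (block c (tmult x y) n b) \<le> pnorm c x * pnorm c y" .
qed

section \<open>The representation on the Hilbert space\<close>

text \<open>The component in one summand C^n. The argument is a bare family rather than an element
  of \<open>hsum\<close>, so that fibres are available before square-summability is known.\<close>

definition fibre :: "(idx \<Rightarrow> complex) \<Rightarrow> nat \<Rightarrow> bool \<Rightarrow> complex vec" where
  "fibre f n b = Matrix.vec n (\<lambda>i. f (n, b, i))"

lemma fibre_carrier [simp]: "fibre f n b \<in> carrier_vec n"
  by (simp add: fibre_def)

lemma vnorm_fibre_sq: "(vnorm (fibre f n b))\<^sup>2 = (\<Sum>i<n. (cmod (f (n, b, i)))\<^sup>2)"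
  by (simp add: fibre_def vnorm_def L2_set_def sum_nonneg)

text \<open>The summands are mutually orthogonal, so a bound with the same constant on every fibre
  adds up to a global one. Stated for finite partial sums, it also yields the square-summability of
  \<open>g\<close>.\<close>

lemma sum_le_fibres:
  assumes g: "\<And>t. \<not> is_idx t \<Longrightarrow> g t = 0" and "0 \<le> C" and "finite F"
    and le: "\<And>n b. vnorm (fibre g n b) \<le> C * vnorm (fibre (coord f) n b)"
  shows "(\<Sum>t\<in>F. (cmod (g t))\<^sup>2) \<le> (C * norm f)\<^sup>2"
proof -
  have "finite (fst ` F)" using \<open>finite F\<close> by simp
  then obtain m where "\<forall>k\<in>fst ` F. k < m" unfolding finite_nat_set_iff_bounded by blast
  then have m: "fst t < m" if "t \<in> F" for t using that by blast
  \<comment> \<open>\<open>D\<close> consists of complete fibres, so sums over it split into squared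
    fibre norms; the members of \<open>F\<close> outside \<open>D\<close> are not valid indices, and
    \<open>g\<close> vanishes there.\<close>
  define D :: "idx set" where "D = (SIGMA n:{..<m}. UNIV \<times> {..<n})"
  have fin: "finite D" unfolding D_def by auto
  have sumD: "(\<Sum>t\<in>D. (cmod (h t))\<^sup>2) = (\<Sum>n<m. \<Sum>b\<in>UNIV. (vnorm (fibre h n b))\<^sup>2)" for h
  proof -
    have "(\<Sum>t\<in>D. (cmod (h t))\<^sup>2) = (\<Sum>n<m. \<Sum>p\<in>UNIV \<times> {..<n}. (cmod (h (n, p)))\<^sup>2)"
      unfolding D_def by (subst sum.Sigma) auto
    also have "\<dots> = (\<Sum>n<m. \<Sum>b\<in>UNIV. \<Sum>i<n. (cmod (h (n, b, i)))\<^sup>2)"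
      by (intro sum.cong refl) (subst sum.cartesian_product, auto)
    finally show ?thesis by (simp only: vnorm_fibre_sq)
  qed
  have "(\<Sum>t\<in>F. (cmod (g t))\<^sup>2) = (\<Sum>t\<in>F \<inter> D. (cmod (g t))\<^sup>2)"
  proof (intro sum.mono_neutral_right ballI)
    fix t assume t: "t \<in> F - F \<inter> D"
    then have "\<not> is_idx t" using m[of t] by (auto simp: D_def is_idx_def)
    then show "(cmod (g t))\<^sup>2 = 0" using g by simp
  qed (use \<open>finite F\<close> in auto)
  also have "\<dots> \<le> (\<Sum>t\<in>D. (cmod (g t))\<^sup>2)"
    using fin by (intro sum_mono2) auto
  also have "\<dots> \<le> (\<Sum>n<m. \<Sum>b\<in>UNIV. (C * vnorm (fibre (coord f) n b))\<^sup>2)"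
    unfolding sumD by (intro sum_mono power_mono le) auto
  also have "\<dots> = C\<^sup>2 * (\<Sum>t\<in>D. (cmod (coord f t))\<^sup>2)"
    unfolding sumD by (simp add: power_mult_distrib sum_distrib_left)
  also have "\<dots> \<le> C\<^sup>2 * (norm f)\<^sup>2"
    using finite_sum_le_norm_hsum[OF fin, of f] by (intro mult_left_mono) auto
  finally show ?thesis by (simp add: power_mult_distrib)
qed

lemma coord_off: "\<not> is_idx t \<Longrightarrow> coord f t = 0"
  using coord[of f] by blast

lemma norm_le_fibres:
  assumes "0 \<le> C" "\<And>n b. vnorm (fibre (coord g) n b) \<le> C * vnorm (fibre (coord f) n b)"
  shows "norm g \<le> C * norm f"
  using assms by (intro norm_hsum_le sum_le_fibres) (auto simp: coord_off)

lemma hsum_eqI: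
  assumes "\<And>n b. fibre (coord f) n b = fibre (coord g) n b"
  shows "f = g"
proof -
  have "coord f t = coord g t" for t
  proof (cases "is_idx t")
    case True
    then obtain n b i where t: "t = (n, b, i)" "i < n" by (cases t) (auto simp: is_idx_def)
    have "vec_index (fibre (coord f) n b) i = vec_index (fibre (coord g) n b) i" using assms by simp
    then show ?thesis using t by (simp add: fibre_def)
  qed (simp add: coord_off)
  then show ?thesis by (metis coord_inject ext)
qed

lemma vnorm_fibre_le_norm: "vnorm (fibre (coord f) n b) \<le> norm f"
proof (rule power2_le_imp_le)
  have "(vnorm (fibre (coord f) n b))\<^sup>2 = (\<Sum>t\<in>(\<lambda>i. (n, b, i)) ` {..<n}. (cmod (coord f t))\<^sup>2)"
    unfolding vnorm_fibre_sq by (subst sum.reindex) (auto simp: inj_on_def)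
  also have "\<dots> \<le> (norm f)\<^sup>2" by (rule finite_sum_le_norm_hsum) simp
  finally show "(vnorm (fibre (coord f) n b))\<^sup>2 \<le> (norm f)\<^sup>2" .
qed simp

lemma fibre_add: "fibre (coord (f + g)) n b = fibre (coord f) n b + fibre (coord g) n b"
  by (intro eq_vecI) (auto simp: fibre_def plus_hsum.rep_eq)

lemma fibre_scaleC: "fibre (coord (a *\<^sub>C f)) n b = a \<cdot>\<^sub>v fibre (coord f) n b"
  by (intro eq_vecI) (auto simp: fibre_def scaleC_hsum_def hscale.rep_eq)

text \<open>Extension by zero from one summand; it supplies the test vectors that detect the norm of
  a single block.\<close>

definition embed :: "nat \<Rightarrow> bool \<Rightarrow> complex vec \<Rightarrow> hsum" where
  "embed n b v = Hsum (\<lambda>(n', b', i). if n' = n \<and> b' = b \<and> i < n then vec_index v i else 0)"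

lemma coord_embed:
  "coord (embed n b v) = (\<lambda>(n', b', i). if n' = n \<and> b' = b \<and> i < n then vec_index v i else 0)"
  unfolding embed_def
proof (rule Hsum_inverse, intro CollectI conjI allI impI)
  let ?g = "\<lambda>(n', b', i). if n' = n \<and> b' = b \<and> i < n then vec_index v i else 0"
  have "finite {t. ?g t \<noteq> 0}"
    by (rule finite_subset[of _ "{n} \<times> {b} \<times> {..<n}"]) (auto split: if_splits)
  then have "(\<lambda>t. (cmod (?g t))\<^sup>2) summable_on {t. ?g t \<noteq> 0}" by (rule summable_on_finite)
  then show "sqsum ?g"
    unfolding sqsum_def by (rule summable_on_cong_neutral[THEN iffD1, rotated -1]) auto
  show "?g t = 0" if "\<not> is_idx t" for t using that by (auto simp: is_idx_def split: prod.splits)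
qed

lemma fibre_embed:
  assumes "v \<in> carrier_vec n"
  shows "fibre (coord (embed n b v)) n b = v"
  using assms by (intro eq_vecI) (auto simp: fibre_def coord_embed)

lemma norm_embed_le:
  assumes "v \<in> carrier_vec n"
  shows "norm (embed n b v) \<le> vnorm v"
proof (rule norm_hsum_le)
  fix F :: "idx set" assume "finite F"
  let ?D = "{n} \<times> {b} \<times> {..<n}"
  have "(\<Sum>t\<in>F. (cmod (coord (embed n b v) t))\<^sup>2) = (\<Sum>t\<in>F \<inter> ?D. (cmod (coord (embed n b v) t))\<^sup>2)"
    using \<open>finite F\<close> by (intro sum.mono_neutral_right) (auto simp: coord_embed split: if_splits)
  also have "\<dots> \<le> (\<Sum>t\<in>?D. (cmod (coord (embed n b v) t))\<^sup>2)"
    by (intro sum_mono2) auto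
  also have "?D = (\<lambda>i. (n, b, i)) ` {..<n}" by auto
  also have "(\<Sum>t\<in>(\<lambda>i. (n, b, i)) ` {..<n}. (cmod (coord (embed n b v) t))\<^sup>2)
      = (vnorm (fibre (coord (embed n b v)) n b))\<^sup>2"
    unfolding vnorm_fibre_sq by (subst sum.reindex) (auto simp: inj_on_def)
  finally show "(\<Sum>t\<in>F. (cmod (coord (embed n b v) t))\<^sup>2) \<le> (vnorm v)\<^sup>2"
    unfolding fibre_embed[OF assms] .
qed simp

text \<open>The family inside \<open>block_op\<close> before \<open>Hsum\<close> is applied,
  isolated because \<open>Hsum\<close> can be inverted only after square-summability has been
  established.\<close>

definition blockwise :: "(nat \<Rightarrow> real) \<Rightarrow> mtuple \<Rightarrow> hsum \<Rightarrow> idx \<Rightarrow> complex" where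
  "blockwise c x f = (\<lambda>(n, b, i).
     if i < n then (\<Sum>j<n. (if b then dconj c x n else x n) $$ (i, j) * coord f (n, b, j)) else 0)"

lemma fibre_blockwise:
  assumes "x \<in> tuples"
  shows "fibre (blockwise c x f) n b = block c x n b *\<^sub>v fibre (coord f) n b"
proof (rule eq_vecI)
  note X = block_carrier[OF assms, of c n b]
  show "dim_vec (fibre (blockwise c x f) n b) = dim_vec (block c x n b *\<^sub>v fibre (coord f) n b)"
    using X by (simp add: fibre_def)
  fix i assume "i < dim_vec (block c x n b *\<^sub>v fibre (coord f) n b)"
  then have "i < n" using X by simp
  then show "vec_index (fibre (blockwise c x f) n b) i
      = vec_index (block c x n b *\<^sub>v fibre (coord f) n b) i"
    using mult_mat_vec_nth[OF X fibre_carrier]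
    by (simp add: fibre_def blockwise_def block_def)
qed

lemma vnorm_block_le:
  assumes x: "x \<in> algN c" and v: "v \<in> carrier_vec n"
  shows "vnorm (block c x n b *\<^sub>v v) \<le> pnorm c x * vnorm v"
proof (cases "n = 0")
  \<comment> \<open>The supremum \<open>pnorm\<close> starts at index 1 and does not control this
    block, but vectors of dimension 0 have norm 0.\<close>
  case True
  then show ?thesis
    using v block_carrier[OF algN_tuples[OF x], of c n b] by (simp add: vnorm_def L2_set_def)
next
  case False
  have "vnorm (block c x n b *\<^sub>v v) \<le> opnorm (block c x n b) * vnorm v"
    using v block_carrier[OF algN_tuples[OF x], of c n b] by (intro vnorm_mult_le)
  also have "\<dots> \<le> pnorm c x * vnorm v"
    using False by (intro mult_right_mono opnorm_block_le_pnorm x) auto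
  finally show ?thesis .
qed

lemma coord_Hsum_blockwise:
  assumes x: "x \<in> algN c"
  shows "coord (Hsum (blockwise c x f)) = blockwise c x f"
proof (rule Hsum_inverse, intro CollectI conjI allI impI)
  show off: "blockwise c x f t = 0" if "\<not> is_idx t" for t
    using that by (auto simp: is_idx_def blockwise_def split: prod.splits)
  show "sqsum (blockwise c x f)"
    unfolding sqsum_def
  proof (rule nonneg_bdd_above_summable_on)
    have "(\<Sum>t\<in>F. (cmod (blockwise c x f t))\<^sup>2) \<le> (pnorm c x * norm f)\<^sup>2" if "finite F" for F
      using off pnorm_nonneg[OF x] that vnorm_block_le[OF x fibre_carrier]
      by (intro sum_le_fibres) (auto simp: fibre_blockwise[OF algN_tuples[OF x]])
    then show "bdd_above (sum (\<lambda>t. (cmod (blockwise c x f t))\<^sup>2) ` {F. F \<subseteq> UNIV \<and> finite F})"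
      by (intro bdd_aboveI2) auto
  qed auto
qed

lemma scaleR_scaleC: "r *\<^sub>R (f::hsum) = complex_of_real r *\<^sub>C f"
  by (simp add: scaleC_of_real)

text \<open>\<open>Blinfun\<close> can be evaluated only once its argument is known to be bounded
  and linear; this and both claims are checked fibre by fibre.\<close>

lemma
  assumes x: "x \<in> algN c"
  shows fibre_block_op: "fibre (coord (block_op c x f)) n b = block c x n b *\<^sub>v fibre (coord f) n b"
    and norm_block_op_le: "norm (block_op c x) \<le> pnorm c x"
proof -
  let ?T = "\<lambda>f. Hsum (blockwise c x f)"
  note X = block_carrier[OF algN_tuples[OF x]]
  have fib: "fibre (coord (?T f)) n b = block c x n b *\<^sub>v fibre (coord f) n b" for f n b
    unfolding coord_Hsum_blockwise[OF x] by (rule fibre_blockwise[OF algN_tuples[OF x]])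
  have le: "norm (?T f) \<le> pnorm c x * norm f" for f
    by (intro norm_le_fibres) (auto simp: fib pnorm_nonneg[OF x] vnorm_block_le[OF x])
  have "bounded_linear ?T"
  proof (rule bounded_linear_intro)
    show "?T (f + g) = ?T f + ?T g" for f g
      by (intro hsum_eqI) (simp add: fib fibre_add mult_add_distrib_mat_vec[OF X])
    show "?T (r *\<^sub>R f) = r *\<^sub>R ?T f" for r f
      by (intro hsum_eqI) (simp add: fib scaleR_scaleC fibre_scaleC mult_mat_vec[OF X])
    show "norm (?T f) \<le> norm f * pnorm c x" for f using le[of f] by (simp add: mult.commute)
  qed
  then have app: "blinfun_apply (block_op c x) = ?T"
    unfolding block_op_def blockwise_def[symmetric] by (rule bounded_linear_Blinfun_apply)
  show "fibre (coord (block_op c x f)) n b = block c x n b *\<^sub>v fibre (coord f) n b"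
    by (simp add: app fib)
  show "norm (block_op c x) \<le> pnorm c x"
    using le by (intro norm_blinfun_bound pnorm_nonneg x) (simp add: app)
qed

text \<open>For the lower bound, a vector embedded in one summand is acted on by the corresponding
  block alone, so no block norm exceeds the norm of the operator.\<close>

lemma norm_block_op:
  assumes x: "x \<in> algN c"
  shows "norm (block_op c x) = pnorm c x"
proof (rule antisym[OF norm_block_op_le[OF x]], rule pnorm_le)
  fix n b
  show "opnorm (block c x n b) \<le> norm (block_op c x)"
  proof (rule opnorm_le[OF block_carrier[OF algN_tuples[OF x]]])
    fix v :: "complex vec" assume v: "v \<in> carrier_vec n"
    have "vnorm (block c x n b *\<^sub>v v) \<le> norm (block_op c x (embed n b v))"
      using vnorm_fibre_le_norm[of "block_op c x (embed n b v)" n b]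
      by (simp add: fibre_block_op[OF x] fibre_embed[OF v])
    also have "\<dots> \<le> norm (block_op c x) * norm (embed n b v)" by (rule norm_blinfun)
    also have "\<dots> \<le> norm (block_op c x) * vnorm v"
      using norm_embed_le[OF v] by (intro mult_left_mono) auto
    finally show "vnorm (block c x n b *\<^sub>v v) \<le> norm (block_op c x) * vnorm v" .
  qed simp
qed

section \<open>Compatibility of the representation with the algebra operations\<close>

lemma block_op_add:
  assumes x: "x \<in> algN c" and y: "y \<in> algN c"
  shows "block_op c (tadd x y) = block_op c x + block_op c y"
proof (intro blinfun_eqI hsum_eqI)
  note t = algN_tuples[OF x] algN_tuples[OF y]
  show "fibre (coord (block_op c (tadd x y) f)) n b = fibre (coord ((block_op c x + block_op c y) f)) n b" for f n b
    by (simp add: plus_blinfun.rep_eq fibre_add fibre_block_op tadd_algN x y block_tadd[OF t]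
        add_mult_distrib_mat_vec[OF block_carrier[OF t(1)] block_carrier[OF t(2)]])
qed

lemma block_op_scaleC_apply:
  assumes x: "x \<in> algN c"
  shows "block_op c (tscale a x) f = a *\<^sub>C block_op c x f"
proof (intro hsum_eqI)
  note X = block_carrier[OF algN_tuples[OF x]]
  show "fibre (coord (block_op c (tscale a x) f)) n b = fibre (coord (a *\<^sub>C block_op c x f)) n b" for n b
    using X[of c n b]
    by (simp add: fibre_scaleC fibre_block_op tscale_algN x block_tscale[OF algN_tuples[OF x]] smult_mat_mult_vec[of _ n n])
qed

lemma block_op_scale:
  assumes x: "x \<in> algN c"
  shows "block_op c (tscale a x) = scale_op a (block_op c x)"
  unfolding scale_op_def block_op_scaleC_apply[OF x, symmetric] by (simp add: blinfun_apply_inverse)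

lemma block_op_minus:
  assumes x: "x \<in> algN c" and y: "y \<in> algN c"
  shows "block_op c (tminus x y) = block_op c x - block_op c y"
proof -
  have "block_op c (tscale (-1) y) = - block_op c y"
  proof (rule blinfun_eqI)
    fix f
    have "block_op c (tscale (-1) y) f = complex_of_real (-1) *\<^sub>C block_op c y f"
      using block_op_scaleC_apply[OF y, of "-1" f] by simp
    then show "block_op c (tscale (-1) y) f = (- block_op c y) f"
      by (simp add: scaleC_of_real uminus_blinfun.rep_eq del: of_real_minus)
  qed
  then show ?thesis
    using x y by (simp add: tminus_eq algN_tuples block_op_add tscale_algN)
qed

lemma block_op_mult:
  assumes c: "\<forall>n\<ge>1. c n > 1" and x: "x \<in> algN c" and y: "y \<in> algN c"
  shows "block_op c (tmult x y) = block_op c x o\<^sub>L block_op c y"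
proof (intro blinfun_eqI hsum_eqI)
  note t = algN_tuples[OF x] algN_tuples[OF y]
  show "fibre (coord (block_op c (tmult x y) f)) n b = fibre (coord ((block_op c x o\<^sub>L block_op c y) f)) n b" for f n b
    by (simp add: blinfun_apply_blinfun_compose fibre_block_op tmult_algN c x y block_tmult[OF c t]
        assoc_mult_mat_vec[OF block_carrier[OF t(1)] block_carrier[OF t(2)]])
qed

lemma block_op_in_bounded_operators:
  assumes x: "x \<in> algN c"
  shows "block_op c x \<in> bounded_operators"
  unfolding bounded_operators_def
proof (intro CollectI allI hsum_eqI)
  show "fibre (coord (block_op c x (a *\<^sub>C f))) n b = fibre (coord (a *\<^sub>C block_op c x f)) n b" for a f n b
    by (simp add: fibre_block_op x fibre_scaleC mult_mat_vec[OF block_carrier[OF algN_tuples[OF x]]])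
qed

lemma block_op_zero: "block_op c tzero = 0"
proof -
  have "pnorm c tzero \<le> 0"
    by (intro pnorm_le opnorm_le[of _ n n for n]) (auto simp: block_tzero zero_mat_mult_vec)
  then have "norm (block_op c tzero) \<le> 0" using norm_block_op[OF tzero_algN, of c] by linarith
  then show ?thesis by simp
qed

text \<open>A convergent sequence of operators is Cauchy in \<open>p\<close>, so the tuples converge
  entrywise to some \<open>x\<close>. Semicontinuity of the operator norm carries the Cauchy
  estimate over to \<open>X k - x\<close>, which gives both membership of \<open>x\<close> in
  \<open>N\<close> and convergence in norm.\<close>

lemma closed_block_op_algN: "closed (block_op c ` algN c)"
  unfolding closed_sequential_limits
proof (intro allI impI, elim conjE)
  fix T L assume T: "\<forall>k. T k \<in> block_op c ` algN c" and lim: "T \<longlonglongrightarrow> L"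
  then have "\<forall>k. \<exists>x. x \<in> algN c \<and> T k = block_op c x" by auto
  from choice[OF this] obtain X where X: "X k \<in> algN c" and TX: "T k = block_op c (X k)" for k
    by auto
  note Xt = algN_tuples[OF X]
  have diff: "tminus (X k) (X l) \<in> algN c" "norm (T k - T l) = pnorm c (tminus (X k) (X l))" for k l
    unfolding TX block_op_minus[OF X X, symmetric] by (intro norm_block_op tminus_algN X)+
  have bdiff: "cmod (X k n $$ (i, j) - X l n $$ (i, j)) \<le> norm (T k - T l)" if "i < n" "j < n" for k l n i j
  proof -
    \<comment> \<open>The unconjugated component is used because its entries are those of the tuple
      itself.\<close>
    have "cmod (block c (tminus (X k) (X l)) n False $$ (i, j)) \<le> opnorm (block c (tminus (X k) (X l)) n False)"
      using that by (intro entry_le_opnorm[OF block_carrier[OF algN_tuples[OF diff(1)]]])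
    also have "\<dots> \<le> norm (T k - T l)"
      unfolding diff(2) using that by (intro opnorm_block_le_pnorm diff(1)) auto
    finally show ?thesis using that tuplesD[OF Xt, of k n] tuplesD[OF Xt, of l n]
      by (simp add: block_def tminus_def)
  qed
  have Cau: "Cauchy T" using lim by (rule LIMSEQ_imp_Cauchy)
  have "Cauchy (\<lambda>k. X k n $$ (i, j))" if "i < n" "j < n" for n i j
  proof (rule CauchyI)
    fix e :: real assume "e > 0"
    then obtain M where "\<forall>k\<ge>M. \<forall>l\<ge>M. norm (T k - T l) < e" using CauchyD[OF Cau] by blast
    then show "\<exists>M. \<forall>k\<ge>M. \<forall>l\<ge>M. norm (X k n $$ (i, j) - X l n $$ (i, j)) < e"
      using bdiff[OF that] by (meson le_less_trans)
  qed
  then have z: "(\<lambda>k. X k n $$ (i, j)) \<longlonglongrightarrow> lim (\<lambda>k. X k n $$ (i, j))" if "i < n" "j < n" for n i j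
    using that Cauchy_convergent convergent_LIMSEQ_iff by blast
  define z where "z n i j = lim (\<lambda>k. X k n $$ (i, j))" for n i j
  note z = z[folded z_def]
  define x where "x = (\<lambda>n. Matrix.mat n n (\<lambda>(i, j). z n i j))"
  have xt: "x \<in> tuples" by (simp add: x_def tuples_def)
  have Dt: "tminus (X k) x \<in> tuples" for k using Xt xt by simp
  \<comment> \<open>With \<open>k\<close> fixed, \<open>l\<close> tends to infinity; entrywise
    convergence passes to the conjugated block since each entry is only multiplied by a
    constant.\<close>
  have close: "opnorm (block c (tminus (X k) x) n b) \<le> e"
    if e: "\<forall>k\<ge>M. \<forall>l\<ge>M. norm (T k - T l) < e" and k: "k \<ge> M" and n: "n \<ge> 1" for e M k n b
  proof (rule opnorm_le_limit[of "\<lambda>l. block c (tminus (X k) (X l)) n b" n n])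
    show "block c (tminus (X k) (X l)) n b \<in> carrier_mat n n" for l
      by (rule block_carrier[OF algN_tuples[OF diff(1)]])
    show "block c (tminus (X k) x) n b \<in> carrier_mat n n"
      by (rule block_carrier[OF Dt])
    show "\<forall>\<^sub>F l in sequentially. opnorm (block c (tminus (X k) (X l)) n b) \<le> e"
      unfolding eventually_sequentially
    proof (intro exI[of _ M] allI impI)
      fix l assume "M \<le> l"
      then have "norm (T k - T l) \<le> e" using e k by (simp add: less_imp_le)
      then show "opnorm (block c (tminus (X k) (X l)) n b) \<le> e"
        unfolding diff(2) using opnorm_block_le_pnorm[OF diff(1) n] order_trans by blast
    qed
    fix i j assume ij: "i < n" "j < n"
    have 1: "tminus (X k) (X l) n $$ (i, j) = X k n $$ (i, j) - X l n $$ (i, j)" for l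
      using ij tuplesD[OF Xt, of l n] by (simp add: tminus_def)
    have 2: "tminus (X k) x n $$ (i, j) = X k n $$ (i, j) - z n i j"
      using ij by (simp add: tminus_def x_def)
    show "(\<lambda>l. block c (tminus (X k) (X l)) n b $$ (i, j)) \<longlonglongrightarrow> block c (tminus (X k) x) n b $$ (i, j)"
      unfolding block_nth[OF algN_tuples[OF diff(1)] ij] block_nth[OF Dt ij] 1 2
      by (cases b) (auto intro!: tendsto_intros z[OF ij])
  qed
  obtain M where M: "\<forall>k\<ge>M. \<forall>l\<ge>M. norm (T k - T l) < 1" using CauchyD[OF Cau, of 1] by auto
  have "tminus (X M) x \<in> algN c" by (rule algNI[OF Dt]) (use close[OF M] in auto)
  \<comment> \<open>Only \<open>X M - x\<close> is known to be bounded so far; subtracting it from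
    \<open>X M\<close> recovers \<open>x\<close>.\<close>
  then have "tminus (X M) (tminus (X M) x) \<in> algN c" by (rule tminus_algN[OF X])
  moreover have "tminus (X M) (tminus (X M) x) = x"
  proof
    fix n show "tminus (X M) (tminus (X M) x) n = x n"
      using tuplesD[OF Xt, of M n] tuplesD[OF xt, of n] by (intro eq_matI) (auto simp: tminus_def)
  qed
  ultimately have x: "x \<in> algN c" by simp
  have "T \<longlonglongrightarrow> block_op c x"
  proof (rule LIMSEQ_I)
    fix r :: real assume "r > 0"
    then obtain M where M: "\<forall>k\<ge>M. \<forall>l\<ge>M. norm (T k - T l) < r / 2" using CauchyD[OF Cau, of "r / 2"] by auto
    have "norm (T k - block_op c x) < r" if "k \<ge> M" for k
    proof -
      have "norm (T k - block_op c x) = pnorm c (tminus (X k) x)"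
        by (simp add: TX block_op_minus[OF X x, symmetric] norm_block_op tminus_algN X x)
      also have "\<dots> \<le> r / 2" by (intro pnorm_le close[OF M that])
      finally show ?thesis using \<open>r > 0\<close> by simp
    qed
    then show "\<exists>no. \<forall>k\<ge>no. norm (T k - block_op c x) < r" by blast
  qed
  then have "L = block_op c x" using lim LIMSEQ_unique by blast
  then show "L \<in> block_op c ` algN c" using x by simp
qed

section \<open>Averages of powers of the shift\<close>

text \<open>The polynomial in the shift \<open>lshift n\<close> with coefficients \<open>w\<close>;
  as the shift is nilpotent, only the \<open>w i\<close> with \<open>i < n\<close> enter.\<close>

definition toeplitz :: "nat \<Rightarrow> (nat \<Rightarrow> complex) \<Rightarrow> complex mat" where
  "toeplitz n w = Matrix.mat n n (\<lambda>(r, s). if r \<le> s then w (s - r) else 0)"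

lemma toeplitz_carrier [simp]: "toeplitz n w \<in> carrier_mat n n"
  by (simp add: toeplitz_def)

lemma toeplitz_nth [simp]:
  "r < n \<Longrightarrow> s < n \<Longrightarrow> toeplitz n w $$ (r, s) = (if r \<le> s then w (s - r) else 0)"
  by (simp add: toeplitz_def)

text \<open>Minkowski's inequality for finitely many terms, by induction from the case of
  two.\<close>

lemma L2_set_norm_sum:
  fixes f :: "'i \<Rightarrow> 'a \<Rightarrow> 'b::real_normed_vector"
  assumes "finite I"
  shows "L2_set (\<lambda>r. norm (\<Sum>i\<in>I. f i r)) A \<le> (\<Sum>i\<in>I. L2_set (\<lambda>r. norm (f i r)) A)"
  using assms
proof (induction I)
  case empty
  then show ?case by (simp add: L2_set_def)
next
  case (insert k I)
  have "L2_set (\<lambda>r. norm (\<Sum>i\<in>insert k I. f i r)) A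
      \<le> L2_set (\<lambda>r. norm (f k r) + norm (\<Sum>i\<in>I. f i r)) A"
    using insert.hyps by (intro L2_set_mono) (auto intro: norm_triangle_ineq)
  also have "\<dots> \<le> L2_set (\<lambda>r. norm (f k r)) A + L2_set (\<lambda>r. norm (\<Sum>i\<in>I. f i r)) A"
    by (rule L2_set_triangle_ineq)
  finally show ?case using insert by simp
qed

lemma toeplitz_mult_vec_nth:
  assumes v: "v \<in> carrier_vec n" and r: "r < n"
  shows "vec_index (toeplitz n w *\<^sub>v v) r = (\<Sum>i<n. w i * (if r + i < n then vec_index v (r + i) else 0))"
proof -
  have "vec_index (toeplitz n w *\<^sub>v v) r = (\<Sum>s<n. toeplitz n w $$ (r, s) * vec_index v s)"
    by (rule mult_mat_vec_nth[OF toeplitz_carrier v r])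
  also have "\<dots> = (\<Sum>s\<in>{r..<n}. w (s - r) * vec_index v s)"
    using r by (intro sum.mono_neutral_cong_right) auto
  also have "\<dots> = (\<Sum>i\<in>{..<n - r}. w i * vec_index v (r + i))"
    by (rule sum.reindex_bij_witness[of _ "\<lambda>i. r + i" "\<lambda>s. s - r"]) auto
  also have "\<dots> = (\<Sum>i<n. w i * (if r + i < n then vec_index v (r + i) else 0))"
    by (intro sum.mono_neutral_cong_left) auto
  finally show ?thesis .
qed

text \<open>Every power of the shift is a contraction, so the triangle inequality leaves the
  absolute sum of the coefficients.\<close>

lemma opnorm_toeplitz: "opnorm (toeplitz n w) \<le> (\<Sum>i<n. cmod (w i))"
proof (rule opnorm_le[OF toeplitz_carrier])
  fix v :: "complex vec" assume v: "v \<in> carrier_vec n"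
  \<comment> \<open>\<open>?S i\<close> is \<open>v\<close> moved by \<open>i\<close> places and
    filled up with zeros, the image of \<open>v\<close> under the \<open>i\<close>-th power of the
    shift.\<close>
  let ?S = "\<lambda>i r. if r + i < n then vec_index v (r + i) else 0"
  have S: "L2_set (\<lambda>r. cmod (?S i r)) {..<n} \<le> vnorm v" for i
  proof -
    have "(\<Sum>r<n. (cmod (?S i r))\<^sup>2) = (\<Sum>r\<in>{..<n - i}. (cmod (vec_index v (r + i)))\<^sup>2)"
      by (intro sum.mono_neutral_cong_right) auto
    also have "\<dots> = (\<Sum>s\<in>{i..<n}. (cmod (vec_index v s))\<^sup>2)"
      by (rule sum.reindex_bij_witness[of _ "\<lambda>s. s - i" "\<lambda>r. r + i"]) auto
    also have "\<dots> \<le> (\<Sum>s<n. (cmod (vec_index v s))\<^sup>2)"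
      by (intro sum_mono2) auto
    finally show ?thesis using v by (simp add: vnorm_def L2_set_def)
  qed
  have "vnorm (toeplitz n w *\<^sub>v v) = L2_set (\<lambda>r. cmod (\<Sum>i<n. w i * ?S i r)) {..<n}"
    unfolding vnorm_def
  proof (rule L2_set_cong)
    show "{..<dim_vec (toeplitz n w *\<^sub>v v)} = {..<n}" by (simp add: toeplitz_def)
  qed (use toeplitz_mult_vec_nth[OF v] in auto)
  also have "\<dots> \<le> (\<Sum>i<n. L2_set (\<lambda>r. cmod (w i * ?S i r)) {..<n})"
    by (rule L2_set_norm_sum) simp
  also have "\<dots> = (\<Sum>i<n. cmod (w i) * L2_set (\<lambda>r. cmod (?S i r)) {..<n})"
    by (simp add: norm_mult L2_set_right_distrib)
  also have "\<dots> \<le> (\<Sum>i<n. cmod (w i) * vnorm v)"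
    by (intro sum_mono mult_left_mono S) auto
  finally show "vnorm (toeplitz n w *\<^sub>v v) \<le> (\<Sum>i<n. cmod (w i)) * vnorm v"
    by (simp add: sum_distrib_right)
qed (auto intro: sum_nonneg)

lemma mat_mult_nth:
  assumes "A \<in> carrier_mat l m" "B \<in> carrier_mat m n" "i < l" "j < n"
  shows "(A * B) $$ (i, j) = (\<Sum>k<m. A $$ (i, k) * B $$ (k, j))"
  using assms by (auto simp: scalar_prod_def atLeast0LessThan intro!: sum.cong)

text \<open>Polynomials in the shift multiply by convolving their coefficients.\<close>

lemma toeplitz_mult:
  "toeplitz n w * toeplitz n w' = toeplitz n (\<lambda>k. \<Sum>i\<le>k. w i * w' (k - i))"
proof (rule eq_matI)
  fix r s
  assume "r < dim_row (toeplitz n (\<lambda>k. \<Sum>i\<le>k. w i * w' (k - i)))"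
    "s < dim_col (toeplitz n (\<lambda>k. \<Sum>i\<le>k. w i * w' (k - i)))"
  then have rs: "r < n" "s < n" by (auto simp: toeplitz_def)
  have "(toeplitz n w * toeplitz n w') $$ (r, s)
      = (\<Sum>t<n. toeplitz n w $$ (r, t) * toeplitz n w' $$ (t, s))"
    by (rule mat_mult_nth[OF toeplitz_carrier toeplitz_carrier rs])
  also have "\<dots> = (\<Sum>t\<in>{r..s}. w (t - r) * w' (s - t))"
    using rs by (intro sum.mono_neutral_cong_right) auto
  also have "\<dots> = toeplitz n (\<lambda>k. \<Sum>i\<le>k. w i * w' (k - i)) $$ (r, s)"
  proof (cases "r \<le> s")
    case True
    then have "(\<Sum>t\<in>{r..s}. w (t - r) * w' (s - t)) = (\<Sum>i\<le>s - r. w i * w' (s - r - i))"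
      by (intro sum.reindex_bij_witness[of _ "\<lambda>i. r + i" "\<lambda>t. t - r"]) auto
    then show ?thesis using True rs by simp
  qed (use rs in auto)
  finally show "(toeplitz n w * toeplitz n w') $$ (r, s)
      = toeplitz n (\<lambda>k. \<Sum>i\<le>k. w i * w' (k - i)) $$ (r, s)" .
qed (auto simp: toeplitz_def)

lemma toeplitz_mult_commute: "toeplitz n w * toeplitz n w' = toeplitz n w' * toeplitz n w"
proof -
  have "(\<Sum>i\<le>k. w i * w' (k - i)) = (\<Sum>i\<le>k. w' i * w (k - i))" for k
    by (rule sum.reindex_bij_witness[of _ "\<lambda>i. k - i" "\<lambda>i. k - i"]) auto
  then show ?thesis by (simp add: toeplitz_mult)
qed

lemma toeplitz_minus: "toeplitz n w - toeplitz n w' = toeplitz n (\<lambda>k. w k - w' k)"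
  by (rule eq_matI) (auto simp: toeplitz_def)

lemma opnorm_block_toeplitz:
  assumes "c n > 1" "x \<in> tuples" "x n = toeplitz n w"
  shows "opnorm (block c x n b) \<le> (\<Sum>i<n. cmod (w i))"
proof -
  \<comment> \<open>The factor by which the shift is scaled in component \<open>b\<close>; the block
    is again a polynomial in the shift, with coefficients \<open>a ^ i * w i\<close>.\<close>
  define a where "a = (if b then inverse (complex_of_real (c n)) else 1)"
  have nz: "complex_of_real (c n) \<noteq> 0" using assms(1) by simp
  have "cmod a \<le> 1"
    using assms(1) by (simp add: a_def norm_inverse inverse_le_1_iff)
  have "block c x n b = toeplitz n (\<lambda>i. a ^ i * w i)"
  proof (rule eq_matI)
    fix r s assume "r < dim_row (toeplitz n (\<lambda>i. a ^ i * w i))" "s < dim_col (toeplitz n (\<lambda>i. a ^ i * w i))"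
    then have rs: "r < n" "s < n" by (auto simp: toeplitz_def)
    \<comment> \<open>The offset from counting entries from 0 cancels; only the distance to the
      diagonal remains.\<close>
    have p: "complex_of_real (c n ^ Suc r) * z * inverse (complex_of_real (c n ^ Suc s)) = a ^ (s - r) * z"
      if "r \<le> s" b for z
    proof -
      define d where "d = s - r"
      have d: "s = r + d" using that(1) by (simp add: d_def)
      let ?P = "complex_of_real (c n ^ Suc r)"
      have P: "?P \<noteq> 0" using nz by simp
      have "complex_of_real (c n ^ Suc s) = ?P * complex_of_real (c n) ^ d"
        by (simp add: d power_add)
      then have "?P * z * inverse (complex_of_real (c n ^ Suc s))
          = (?P * inverse ?P) * (inverse (complex_of_real (c n) ^ d) * z)"
        by (simp only: inverse_mult_distrib mult_ac)
      also have "?P * inverse ?P = 1" using P by (rule right_inverse)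
      finally show ?thesis using that(2) by (simp add: d a_def power_inverse)
    qed
    show "block c x n b $$ (r, s) = toeplitz n (\<lambda>i. a ^ i * w i) $$ (r, s)"
    proof (cases "b \<and> r \<le> s")
      case True
      then show ?thesis
        unfolding block_nth[OF assms(2) rs] assms(3) toeplitz_nth[OF rs]
        by (simp only: p if_True)
    next
      case False
      then show ?thesis
        unfolding block_nth[OF assms(2) rs] assms(3) toeplitz_nth[OF rs]
        by (auto simp: a_def)
    qed
  qed (use block_carrier[OF assms(2), of c n b] in \<open>auto simp: toeplitz_def\<close>)
  then have "opnorm (block c x n b) \<le> (\<Sum>i<n. cmod (a ^ i * w i))"
    by (simp add: opnorm_toeplitz)
  also have "\<dots> \<le> (\<Sum>i<n. cmod (w i))"
    using \<open>cmod a \<le> 1\<close>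
    by (intro sum_mono) (auto simp: norm_mult norm_power power_le_one intro!: mult_left_le_one_le)
  finally show ?thesis .
qed

section \<open>The averages as polynomials in the shift\<close>

lemma lshift_pow_nth:
  assumes "r < n" "s < n"
  shows "(lshift n ^\<^sub>m i) $$ (r, s) = (if s = r + i then 1 else 0)"
  using assms(2)
proof (induction i arbitrary: s)
  case 0
  then show ?case using assms(1) by (auto simp: lshift_def)
next
  case (Suc i)
  have L: "lshift n \<in> carrier_mat n n" by (simp add: lshift_def)
  then have P: "lshift n ^\<^sub>m i \<in> carrier_mat n n" by (rule pow_carrier_mat)
  have "(lshift n ^\<^sub>m Suc i) $$ (r, s) = (\<Sum>t<n. (lshift n ^\<^sub>m i) $$ (r, t) * lshift n $$ (t, s))"
    using mat_mult_nth[OF P L assms(1) Suc.prems] by simp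
  also have "\<dots> = (\<Sum>t<n. if t = r + i then (if s = Suc (r + i) then 1 else 0) else 0)"
    using Suc by (intro sum.cong) (auto simp: lshift_def)
  also have "\<dots> = (if s = r + Suc i then 1 else 0)"
    using Suc.prems by auto
  finally show ?case .
qed

text \<open>\<open>uweight n k i\<close> is the coefficient of \<open>L\<^sub>n\<^sup>i\<close> in \<open>u\<^bsub>n,k\<^esub>\<close>.\<close>

definition uweight :: "nat \<Rightarrow> nat \<Rightarrow> nat \<Rightarrow> complex" where
  "uweight n k i =
     (if n < k then (if i = 0 then 1 else 0)
      else if i \<in> Eset n k then 1 / of_nat (card (Eset n k)) else 0)"

lemma finite_Eset [simp]: "finite (Eset n k)"
proof (rule finite_subset)
  show "Eset n k \<subseteq> {..nat \<lfloor>2 * real n / real k\<rfloor>}"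
    by (auto simp: Eset_def le_nat_floor)
qed simp

lemma useq_eq: "useq k n = toeplitz n (uweight n k)"
proof (rule eq_matI)
  fix r s assume "r < dim_row (toeplitz n (uweight n k))" "s < dim_col (toeplitz n (uweight n k))"
  then have rs: "r < n" "s < n" by (auto simp: toeplitz_def)
  have "(\<Sum>i\<in>Eset n k. (lshift n ^\<^sub>m i) $$ (r, s)) = (if r \<le> s \<and> s - r \<in> Eset n k then 1 else 0)"
  proof -
    have "(\<Sum>i\<in>Eset n k. (lshift n ^\<^sub>m i) $$ (r, s))
        = (\<Sum>i\<in>Eset n k. if i = s - r then (if r \<le> s then 1 else 0) else 0)"
      using rs by (intro sum.cong) (auto simp: lshift_pow_nth)
    also have "\<dots> = (if r \<le> s \<and> s - r \<in> Eset n k then 1 else 0)" by simp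
    finally show ?thesis .
  qed
  then show "useq k n $$ (r, s) = toeplitz n (uweight n k) $$ (r, s)"
    using rs by (auto simp: useq_def ublock_def uweight_def)
qed (auto simp: useq_def ublock_def toeplitz_def)

lemma useq_tuples: "useq k \<in> tuples"
  by (simp add: tuples_def useq_eq)

text \<open>The weights are uniform with total mass 1, but exponents from \<open>n\<close> on are
  cut off, as for \<open>k = 1\<close>. At \<open>k = 0\<close>, division by zero gives
  \<open>Eset n 0 = {0}\<close>, so the average is the identity.\<close>

lemma sum_uweight_le: "(\<Sum>i<n. cmod (uweight n k i)) \<le> 1"
proof (cases "n < k")
  case True
  have "(\<Sum>i<n. cmod (uweight n k i)) = (\<Sum>i<n. if i = 0 then 1 else 0)"
    using True by (intro sum.cong) (auto simp: uweight_def)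
  then show ?thesis by simp
next
  case False
  have "(\<Sum>i<n. cmod (uweight n k i)) = (\<Sum>i\<in>{..<n} \<inter> Eset n k. 1 / real (card (Eset n k)))"
    using False by (intro sum.mono_neutral_cong_right) (auto simp: uweight_def norm_divide)
  also have "\<dots> \<le> (\<Sum>i\<in>Eset n k. 1 / real (card (Eset n k)))"
    by (intro sum_mono2) auto
  also have "\<dots> \<le> 1" by simp
  finally show ?thesis .
qed

lemma useq_algN:
  assumes "\<forall>n\<ge>1. c n > 1"
  shows "useq k \<in> algN c" "pnorm c (useq k) \<le> 1"
proof -
  have le: "opnorm (block c (useq k) n b) \<le> 1" if "n \<ge> 1" for n b
    using opnorm_block_toeplitz[OF _ useq_tuples useq_eq, of c n k b] sum_uweight_le[of n k] assms that
    by fastforce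
  show "useq k \<in> algN c" using le by (rule algNI[OF useq_tuples])
  show "pnorm c (useq k) \<le> 1" using le by (rule pnorm_le)
qed

text \<open>In this form a translate visibly differs from the original set only near the two
  endpoints.\<close>

lemma Eset_interval:
  "Eset n k = {nat \<lceil>real n / real k\<rceil>..nat \<lfloor>2 * real n / real k\<rfloor>}"
  by (auto simp: Eset_def ceiling_le_iff le_nat_iff nat_le_iff le_floor_iff)

lemma card_Eset_ge:
  assumes "1 \<le> k" "k \<le> n"
  shows "real n / (2 * real k) \<le> real (card (Eset n k))" "Eset n k \<noteq> {}"
proof -
  define t where "t = real n / real k"
  have t: "1 \<le> t" using assms by (simp add: t_def)
  have E: "Eset n k = {nat \<lceil>t\<rceil>..nat \<lfloor>2 * t\<rfloor>}" unfolding Eset_interval t_def by simp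
  have le: "\<lceil>t\<rceil> \<le> \<lfloor>2 * t\<rfloor>" unfolding le_floor_iff using t by linarith
  have "0 \<le> \<lceil>t\<rceil>" "0 \<le> \<lfloor>2 * t\<rfloor>" using t by linarith+
  then have card: "real (card (Eset n k)) = of_int (\<lfloor>2 * t\<rfloor> + 1 - \<lceil>t\<rceil>)"
    using le by (simp add: E of_nat_diff nat_le_iff)
  have "t / 2 \<le> real (card (Eset n k))"
  \<comment> \<open>The number of elements exceeds \<open>t - 1\<close>, which is at least
    \<open>t / 2\<close> when \<open>t \<ge> 2\<close>; for smaller \<open>t\<close> a single
    element suffices.\<close>
  proof (cases "t < 2")
    case True
    moreover have "1 \<le> real (card (Eset n k))" unfolding card using le by linarith
    ultimately show ?thesis by linarith
  qed (use card in linarith)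
  then show "real n / (2 * real k) \<le> real (card (Eset n k))" by (simp add: t_def field_simps)
  show "Eset n k \<noteq> {}"
    using nat_mono[OF le] by (simp only: E atLeastatMost_empty_iff not_not simp_thms)
qed

text \<open>The symmetric difference of an interval and its translate by \<open>j\<close> lies in
  two intervals of \<open>j\<close> points each, one at either end.\<close>

lemma sum_shift_interval_diff:
  fixes a b j n :: nat
  shows "(\<Sum>i<n. \<bar>of_bool (j \<le> i \<and> i - j \<in> {a..b}) - of_bool (i \<in> {a..b}) :: real\<bar>) \<le> 2 * real j"
proof -
  have "(\<Sum>i<n. \<bar>of_bool (j \<le> i \<and> i - j \<in> {a..b}) - of_bool (i \<in> {a..b}) :: real\<bar>)
      \<le> (\<Sum>i<n. of_bool (i \<in> {a..<a + j}) + of_bool (i \<in> {b<..b + j}))"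
    by (intro sum_mono) (auto simp: of_bool_def)
  also have "\<dots> = real (card ({..<n} \<inter> {a..<a + j})) + real (card ({..<n} \<inter> {b<..b + j}))"
    by (simp add: sum.distrib sum.If_cases of_bool_def Int_def)
  also have "\<dots> \<le> real (card {a..<a + j}) + real (card {b<..b + j})"
    by (intro add_mono of_nat_mono card_mono) auto
  finally show ?thesis by simp
qed

text \<open>Convolution with \<open>uweight n k\<close> averages translates of
  \<open>uweight n m\<close> by \<open>j \<le> 2n/k\<close>. Such a translate differs from the
  original by at most \<open>2j/M\<close> in total, where \<open>M \<ge> n/(2m)\<close> counts its
  support; the product of these bounds is \<open>8m/k\<close>. For \<open>n < k\<close> the
  convolution changes nothing.\<close>

lemma sum_uweight_conv_diff:
  assumes m: "1 \<le> m" "m \<le> k"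
  shows "(\<Sum>i<n. cmod ((\<Sum>j\<le>i. uweight n k j * uweight n m (i - j)) - uweight n m i)) \<le> 8 * real m / real k"
proof (cases "n < k")
  case True
  have "(\<Sum>j\<le>i. uweight n k j * uweight n m (i - j)) = (\<Sum>j\<le>i. if j = 0 then uweight n m i else 0)" for i
    using True by (intro sum.cong) (auto simp: uweight_def)
  then show ?thesis by simp
next
  case False
  define M where "M = real (card (Eset n m))"
  define K where "K = real (card (Eset n k))"
  have "n > 0" using False m by simp
  have le: "real n / (2 * real m) \<le> M" unfolding M_def using False m by (intro card_Eset_ge) auto
  have pos: "0 < real n / (2 * real m)" using \<open>n > 0\<close> m by simp
  have M: "M > 0" using le pos by linarith
  have M_le: "1 / M \<le> 2 * real m / real n"
    using le_imp_inverse_le[OF le pos] by (simp add: inverse_eq_divide)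
  have "Eset n k \<noteq> {}" using False m by (intro card_Eset_ge) auto
  then have K: "K > 0" unfolding K_def by (simp add: card_gt_0_iff)
  \<comment> \<open>The weights of \<open>u_m\<close> translated by \<open>j\<close>; the zero value
    for \<open>j > i\<close> lets the sum run over all of \<open>Eset n k\<close>.\<close>
  define sh where "sh j i = (if j \<le> i then uweight n m (i - j) else 0)" for j i
  have conv: "(\<Sum>j\<le>i. uweight n k j * uweight n m (i - j)) - uweight n m i
      = (\<Sum>j\<in>Eset n k. (sh j i - uweight n m i) / of_real K)" for i
  proof -
    have "(\<Sum>j\<le>i. uweight n k j * uweight n m (i - j)) = (\<Sum>j\<in>{..i} \<inter> Eset n k. sh j i / of_real K)"
      using False by (intro sum.mono_neutral_cong_right) (auto simp: uweight_def sh_def K_def)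
    also have "\<dots> = (\<Sum>j\<in>Eset n k. sh j i / of_real K)"
      by (intro sum.mono_neutral_left) (auto simp: sh_def)
    finally have 1: "(\<Sum>j\<le>i. uweight n k j * uweight n m (i - j)) = (\<Sum>j\<in>Eset n k. sh j i / of_real K)" .
    \<comment> \<open>The averaging weights have total mass 1, so the subtracted term can be moved
      inside the average.\<close>
    have "(\<Sum>j\<in>Eset n k. uweight n m i / of_real K) = of_real K * (uweight n m i / of_real K)"
      by (simp only: sum_constant K_def of_real_of_nat_eq)
    also have "\<dots> = uweight n m i" using K by simp
    finally have "(\<Sum>j\<in>Eset n k. uweight n m i / of_real K) = uweight n m i" .
    then show ?thesis unfolding 1 by (simp add: diff_divide_distrib sum_subtractf)
  qed
  have sh: "(\<Sum>i<n. cmod (sh j i - uweight n m i)) \<le> 8 * real m / real k" if "j \<in> Eset n k" for j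
  proof -
    obtain a b where E: "Eset n m = {a..b}" using Eset_interval by blast
    \<comment> \<open>Here \<open>m \<le> k \<le> n\<close>, so the uniform branch of
      \<open>uweight n m\<close> applies.\<close>
    have w: "uweight n m i = complex_of_real (1 / M * of_bool (i \<in> {a..b}))" for i
      using False m by (simp add: uweight_def E[symmetric] M_def)
    have "sh j i - uweight n m i
        = complex_of_real (1 / M * (of_bool (j \<le> i \<and> i - j \<in> {a..b}) - of_bool (i \<in> {a..b})))" for i
      unfolding sh_def w by (cases "j \<le> i") (simp_all only: right_diff_distrib of_real_diff simp_thms if_True if_False of_bool_eq mult_zero_right of_real_0)
    then have "cmod (sh j i - uweight n m i)
        = 1 / M * \<bar>of_bool (j \<le> i \<and> i - j \<in> {a..b}) - of_bool (i \<in> {a..b})\<bar>" for i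
      using M by (simp only: norm_of_real abs_mult) simp
    then have "(\<Sum>i<n. cmod (sh j i - uweight n m i))
        = 1 / M * (\<Sum>i<n. \<bar>of_bool (j \<le> i \<and> i - j \<in> {a..b}) - of_bool (i \<in> {a..b}) :: real\<bar>)"
      by (simp add: sum_distrib_left)
    also have "\<dots> \<le> 1 / M * (2 * real j)"
      using M by (intro mult_left_mono sum_shift_interval_diff) auto
    also have "\<dots> \<le> (2 * real m / real n) * (2 * (2 * real n / real k))"
      using M M_le that by (intro mult_mono) (auto simp: Eset_def)
    also have "\<dots> = 8 * real m / real k" using \<open>n > 0\<close> by simp
    finally show ?thesis .
  qed
  have "(\<Sum>i<n. cmod ((\<Sum>j\<le>i. uweight n k j * uweight n m (i - j)) - uweight n m i))
      \<le> (\<Sum>i<n. \<Sum>j\<in>Eset n k. cmod (sh j i - uweight n m i) / K)"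
    unfolding conv
  proof (rule sum_mono)
    fix i
    show "cmod (\<Sum>j\<in>Eset n k. (sh j i - uweight n m i) / of_real K)
        \<le> (\<Sum>j\<in>Eset n k. cmod (sh j i - uweight n m i) / K)"
      using K by (intro order_trans[OF norm_sum] sum_mono) (simp add: norm_divide)
  qed
  also have "\<dots> = (\<Sum>j\<in>Eset n k. (\<Sum>i<n. cmod (sh j i - uweight n m i)) / K)"
    by (subst sum.swap) (simp add: sum_divide_distrib)
  also have "\<dots> \<le> (\<Sum>j\<in>Eset n k. (8 * real m / real k) / K)"
    using K by (intro sum_mono divide_right_mono sh) auto
  also have "\<dots> = K * ((8 * real m / real k) / K)" by (simp only: sum_constant K_def)
  also have "\<dots> = 8 * real m / real k" using K by simp
  finally show ?thesis .
qed

lemma useq_commute: "tmult (useq m) (useq k) = tmult (useq k) (useq m)"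
  unfolding tmult_def useq_eq by (metis toeplitz_mult_commute)

lemma pnorm_useq_mult_diff:
  assumes "\<forall>n\<ge>1. c n > 1" "1 \<le> m" "m \<le> k"
  shows "pnorm c (tminus (tmult (useq k) (useq m)) (useq m)) \<le> 8 * real m / real k"
proof (rule pnorm_le)
  fix n :: nat and b assume "n \<ge> 1"
  let ?w = "\<lambda>i. (\<Sum>j\<le>i. uweight n k j * uweight n m (i - j)) - uweight n m i"
  have "opnorm (block c (tminus (tmult (useq k) (useq m)) (useq m)) n b) \<le> (\<Sum>i<n. cmod (?w i))"
  proof (rule opnorm_block_toeplitz)
    show "tminus (tmult (useq k) (useq m)) (useq m) n = toeplitz n ?w"
      by (simp add: tminus_def tmult_def useq_eq toeplitz_mult toeplitz_minus)
  qed (use assms \<open>n \<ge> 1\<close> useq_tuples in auto)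
  also have "\<dots> \<le> 8 * real m / real k" by (rule sum_uweight_conv_diff[OF assms(2,3)])
  finally show "opnorm (block c (tminus (tmult (useq k) (useq m)) (useq m)) n b) \<le> 8 * real m / real k" .
qed

section \<open>The algebra \<open>A\<close>\<close>

interpretation blinfun_compose: bounded_bilinear "(o\<^sub>L)"
  by (rule bounded_bilinear_blinfun_compose)

lemma blinfun_compose_assoc: "(a o\<^sub>L b) o\<^sub>L d = a o\<^sub>L (b o\<^sub>L d)"
  by (rule blinfun_eqI) simp

context
  fixes c :: "nat \<Rightarrow> real"
  assumes c: "\<forall>n\<ge>1. c n > 1"
begin

abbreviation (input) \<pi> :: "mtuple \<Rightarrow> hsum \<Rightarrow>\<^sub>L hsum" where "\<pi> \<equiv> block_op c"

lemma pnorm_mult_diff: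
  assumes "x \<in> algN c" "y \<in> algN c" "z \<in> algN c"
  shows "pnorm c (tminus (tmult x y) z) = norm ((\<pi> x o\<^sub>L \<pi> y) - \<pi> z)"
  using assms c by (simp add: norm_block_op[symmetric] tminus_algN tmult_algN block_op_minus block_op_mult)

text \<open>A sum of two nonnegative sequences is null exactly if both are. Transported by the
  isometry \<open>\<pi>\<close>, membership becomes two operator limits, to which continuity of
  composition applies.\<close>

lemma algA_iff:
  "x \<in> algA c \<longleftrightarrow> x \<in> algN c \<and> (\<lambda>k. \<pi> x o\<^sub>L \<pi> (useq k)) \<longlonglongrightarrow> \<pi> x \<and> (\<lambda>k. \<pi> (useq k) o\<^sub>L \<pi> x) \<longlonglongrightarrow> \<pi> x"
proof (cases "x \<in> algN c")
  case True
  let ?f = "\<lambda>k. norm ((\<pi> x o\<^sub>L \<pi> (useq k)) - \<pi> x)" and ?g = "\<lambda>k. norm ((\<pi> (useq k) o\<^sub>L \<pi> x) - \<pi> x)"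
  have "(\<lambda>k. ?f k + ?g k) \<longlonglongrightarrow> 0 \<longleftrightarrow> ?f \<longlonglongrightarrow> 0 \<and> ?g \<longlonglongrightarrow> 0"
  proof
    assume *: "(\<lambda>k. ?f k + ?g k) \<longlonglongrightarrow> 0"
    show "?f \<longlonglongrightarrow> 0 \<and> ?g \<longlonglongrightarrow> 0"
      by (intro conjI; rule tendsto_sandwich[OF _ _ tendsto_const *]) auto
  qed (use tendsto_add[of ?f 0 _ ?g 0] in auto)
  then show ?thesis
    using True useq_algN(1)[OF c]
    by (simp add: algA_def pnorm_mult_diff tendsto_norm_zero_iff LIM_zero_iff)
qed (simp add: algA_def)

lemma algA_algN: "x \<in> algA c \<Longrightarrow> x \<in> algN c"
  by (simp add: algA_def)

lemma norm_block_op_useq: "norm (\<pi> (useq k)) \<le> 1"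
  using useq_algN[OF c] by (simp add: norm_block_op)

lemma tzero_algA: "tzero \<in> algA c"
  by (simp add: algA_iff tzero_algN block_op_zero blinfun_compose_zero)

lemma tadd_algA:
  assumes "x \<in> algA c" "y \<in> algA c"
  shows "tadd x y \<in> algA c"
  using assms unfolding algA_iff
  by (auto simp: tadd_algN block_op_add blinfun_compose.add_left blinfun_compose.add_right intro!: tendsto_add)

text \<open>Each side needs only the adjacent factor: \<open>y\<close> absorbs \<open>u_k\<close> on
  the right, \<open>x\<close> absorbs it on the left.\<close>

lemma tmult_algA:
  assumes "x \<in> algA c" "y \<in> algA c"
  shows "tmult x y \<in> algA c"
proof -
  note N = assms[THEN algA_algN]
  have "(\<lambda>k. \<pi> x o\<^sub>L (\<pi> y o\<^sub>L \<pi> (useq k))) \<longlonglongrightarrow> (\<pi> x o\<^sub>L \<pi> y)"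
    using assms(2) by (intro blinfun_compose.tendsto tendsto_const) (simp add: algA_iff)
  moreover have "(\<lambda>k. (\<pi> (useq k) o\<^sub>L \<pi> x) o\<^sub>L \<pi> y) \<longlonglongrightarrow> (\<pi> x o\<^sub>L \<pi> y)"
    using assms(1) by (intro blinfun_compose.tendsto tendsto_const) (simp add: algA_iff)
  ultimately show ?thesis
    using N c by (simp add: algA_iff tmult_algN block_op_mult blinfun_compose_assoc)
qed

lemma tmult_tscale:
  assumes "x \<in> tuples" "y \<in> tuples"
  shows "tmult (tscale a x) y = tscale a (tmult x y)" "tmult x (tscale a y) = tscale a (tmult x y)"
  using mult_smult_assoc_mat[OF tuplesD[OF assms(1)] tuplesD[OF assms(2)]]
    mult_smult_distrib[OF tuplesD[OF assms(1)] tuplesD[OF assms(2)]]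
  by (auto simp: tmult_def tscale_def)

lemma tscale_tminus:
  assumes "x \<in> tuples" "y \<in> tuples"
  shows "tscale a (tminus x y) = tminus (tscale a x) (tscale a y)"
proof
  fix n show "tscale a (tminus x y) n = tminus (tscale a x) (tscale a y) n"
    using tuplesD[OF assms(1), of n] tuplesD[OF assms(2), of n]
    by (intro eq_matI) (auto simp: tscale_def tminus_def right_diff_distrib)
qed

text \<open>Operators form a real normed space here, so continuity of complex scaling is derived
  from the norms of the blocks.\<close>

lemma norm_block_op_tscale_diff:
  assumes "x \<in> algN c" "y \<in> algN c"
  shows "norm (\<pi> (tscale a x) - \<pi> (tscale a y)) \<le> cmod a * norm (\<pi> x - \<pi> y)"
proof -
  let ?z = "tminus x y"
  have z: "?z \<in> algN c" using assms by (rule tminus_algN)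
  have "norm (\<pi> (tscale a x) - \<pi> (tscale a y)) = pnorm c (tscale a ?z)"
    using assms by (simp add: block_op_minus[symmetric] tscale_algN tscale_tminus algN_tuples norm_block_op tminus_algN)
  also have "\<dots> \<le> cmod a * pnorm c ?z"
  proof (rule pnorm_le)
    fix n :: nat and b assume n: "n \<ge> 1"
    have "opnorm (block c (tscale a ?z) n b) \<le> cmod a * opnorm (block c ?z n b)"
      unfolding block_tscale[OF algN_tuples[OF z]] by (rule opnorm_smult_le[OF block_carrier[OF algN_tuples[OF z]]])
    also have "\<dots> \<le> cmod a * pnorm c ?z"
      using opnorm_block_le_pnorm[OF z n, of b] by (intro mult_left_mono) auto
    finally show "opnorm (block c (tscale a ?z) n b) \<le> cmod a * pnorm c ?z" .
  qed
  also have "pnorm c ?z = norm (\<pi> x - \<pi> y)"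
    using assms z by (simp add: block_op_minus[symmetric] norm_block_op)
  finally show ?thesis .
qed

lemma tscale_algA:
  assumes "x \<in> algA c"
  shows "tscale a x \<in> algA c"
proof -
  have N: "x \<in> algN c" using assms by (rule algA_algN)
  note t = algN_tuples[OF N] and u = useq_tuples
  have tend: "(\<lambda>k. \<pi> (tscale a (z k))) \<longlonglongrightarrow> \<pi> (tscale a x)"
    if z: "\<And>k. z k \<in> algN c" "(\<lambda>k. \<pi> (z k)) \<longlonglongrightarrow> \<pi> x" for z
  proof (rule Lim_null[THEN iffD2], rule tendsto_norm_zero_cancel, rule tendsto_sandwich[where f = "\<lambda>_. 0"])
    show "(\<lambda>k. cmod a * norm (\<pi> (z k) - \<pi> x)) \<longlonglongrightarrow> 0"
      using z(2) by (intro tendsto_mult_right_zero tendsto_norm_zero) (simp add: LIM_zero_iff)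
    show "\<forall>\<^sub>F k in sequentially. norm (\<pi> (tscale a (z k)) - \<pi> (tscale a x)) \<le> cmod a * norm (\<pi> (z k) - \<pi> x)"
      by (simp add: norm_block_op_tscale_diff z N)
  qed auto
  have "(\<lambda>k. \<pi> (tscale a (tmult x (useq k)))) \<longlonglongrightarrow> \<pi> (tscale a x)"
    using assms useq_algN(1)[OF c] c by (intro tend tmult_algN N) (auto simp: algA_iff block_op_mult N)
  moreover have "(\<lambda>k. \<pi> (tscale a (tmult (useq k) x))) \<longlonglongrightarrow> \<pi> (tscale a x)"
    using assms useq_algN(1)[OF c] c by (intro tend tmult_algN N) (auto simp: algA_iff block_op_mult N)
  ultimately show ?thesis
    using useq_algN(1)[OF c] c N
    by (simp add: algA_iff tscale_algN block_op_mult[symmetric] tmult_tscale t u)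
qed

lemma subalgebra_algA: "subalgebra (algA c)"
  unfolding subalgebra_def
  using tzero_algA tadd_algA tscale_algA tmult_algA algN_tuples[OF algA_algN] by blast

text \<open>A three-epsilon argument: composing with the contraction \<open>\<pi> (useq k)\<close>
  does not enlarge the distance from \<open>x\<close> to an approximant in \<open>A\<close>,
  uniformly in \<open>k\<close>.\<close>

lemma algA_closed:
  assumes x: "x \<in> algN c" and approx: "\<And>e. e > 0 \<Longrightarrow> \<exists>a\<in>algA c. norm (\<pi> x - \<pi> a) < e"
  shows "x \<in> algA c"
proof -
  have "\<exists>K. \<forall>k\<ge>K. norm ((\<pi> x o\<^sub>L \<pi> (useq k)) - \<pi> x) < e \<and> norm ((\<pi> (useq k) o\<^sub>L \<pi> x) - \<pi> x) < e"
    if "e > 0" for e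
  proof -
    obtain a where a: "a \<in> algA c" "norm (\<pi> x - \<pi> a) < e / 3" using approx[of "e / 3"] \<open>e > 0\<close> by auto
    have "(\<lambda>k. \<pi> a o\<^sub>L \<pi> (useq k)) \<longlonglongrightarrow> \<pi> a" "(\<lambda>k. \<pi> (useq k) o\<^sub>L \<pi> a) \<longlonglongrightarrow> \<pi> a"
      using a by (simp_all add: algA_iff)
    from LIMSEQ_D[OF this(1), of "e / 3"] LIMSEQ_D[OF this(2), of "e / 3"] \<open>e > 0\<close>
    obtain K1 K2 where K: "\<And>k. k \<ge> K1 \<Longrightarrow> norm ((\<pi> a o\<^sub>L \<pi> (useq k)) - \<pi> a) < e / 3"
      "\<And>k. k \<ge> K2 \<Longrightarrow> norm ((\<pi> (useq k) o\<^sub>L \<pi> a) - \<pi> a) < e / 3"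
      by auto
    \<comment> \<open>\<open>P\<close> and \<open>Q\<close> stand for the compositions of
      \<open>\<pi> x\<close> and \<open>\<pi> a\<close> with \<open>\<pi> (useq k)\<close>, on the
      same side.\<close>
    have tri: "norm (P - \<pi> x) < e"
      if "norm (P - Q) \<le> norm (\<pi> x - \<pi> a)" "norm (Q - \<pi> a) < e / 3" for P Q :: "hsum \<Rightarrow>\<^sub>L hsum"
    proof -
      have "norm (P - \<pi> x) \<le> norm (P - Q) + norm (Q - \<pi> a) + norm (\<pi> a - \<pi> x)"
        using norm_triangle_ineq[of "(P - Q) + (Q - \<pi> a)" "\<pi> a - \<pi> x"] norm_triangle_ineq[of "P - Q" "Q - \<pi> a"]
        by simp
      then show ?thesis using that a(2) norm_minus_commute[of "\<pi> a" "\<pi> x"] by linarith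
    qed
    have r: "norm ((\<pi> x o\<^sub>L \<pi> (useq k)) - (\<pi> a o\<^sub>L \<pi> (useq k))) \<le> norm (\<pi> x - \<pi> a)" for k
      unfolding blinfun_compose.diff_left[symmetric]
      using norm_blinfun_compose[of "\<pi> x - \<pi> a" "\<pi> (useq k)"] norm_block_op_useq[of k]
      by (meson mult_left_le norm_ge_zero order_trans)
    have l: "norm ((\<pi> (useq k) o\<^sub>L \<pi> x) - (\<pi> (useq k) o\<^sub>L \<pi> a)) \<le> norm (\<pi> x - \<pi> a)" for k
      unfolding blinfun_compose.diff_right[symmetric]
      using norm_blinfun_compose[of "\<pi> (useq k)" "\<pi> x - \<pi> a"] norm_block_op_useq[of k]
      by (meson mult_left_le_one_le norm_ge_zero order_trans)
    show ?thesis
      by (rule exI[of _ "max K1 K2"]) (auto intro: tri[OF r K(1)] tri[OF l K(2)])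
  qed
  then have "(\<lambda>k. \<pi> x o\<^sub>L \<pi> (useq k)) \<longlonglongrightarrow> \<pi> x" "(\<lambda>k. \<pi> (useq k) o\<^sub>L \<pi> x) \<longlonglongrightarrow> \<pi> x"
    by (intro LIMSEQ_I; blast)+
  then show ?thesis using x by (simp add: algA_iff)
qed

lemma closed_block_op_algA: "closed (\<pi> ` algA c)"
  unfolding closed_sequential_limits
proof (intro allI impI, elim conjE)
  fix T L assume T: "\<forall>k. T k \<in> \<pi> ` algA c" and lim: "T \<longlonglongrightarrow> L"
  have "\<forall>k. T k \<in> \<pi> ` algN c" using T algA_algN by blast
  then have "L \<in> \<pi> ` algN c"
    using closed_block_op_algN[of c] lim unfolding closed_sequential_limits by blast
  then obtain x where x: "x \<in> algN c" "L = \<pi> x" by auto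
  have "x \<in> algA c"
  proof (rule algA_closed[OF x(1)])
    fix e :: real assume "e > 0"
    then obtain k where "norm (T k - L) < e" using LIMSEQ_D[OF lim] by blast
    then show "\<exists>a\<in>algA c. norm (\<pi> x - \<pi> a) < e"
      using T x(2) by (metis imageE norm_minus_commute)
  qed
  then show "L \<in> \<pi> ` algA c" using x(2) by simp
qed

lemma operator_algebra_algA: "operator_algebra_via \<pi> (pnorm c) (algA c)"
proof -
  have "operator_algebra (\<pi> ` algA c)"
    unfolding operator_algebra_def
  proof (intro conjI)
    show "\<pi> ` algA c \<subseteq> bounded_operators" using block_op_in_bounded_operators algA_algN by blast
    show "0 \<in> \<pi> ` algA c" using tzero_algA block_op_zero[of c] by (metis imageI)
    show "\<forall>T\<in>\<pi> ` algA c. \<forall>U\<in>\<pi> ` algA c. T + U \<in> \<pi> ` algA c"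
      by (auto simp: algA_algN block_op_add[symmetric] tadd_algA)
    show "\<forall>a. \<forall>T\<in>\<pi> ` algA c. scale_op a T \<in> \<pi> ` algA c"
      by (auto simp: algA_algN block_op_scale[symmetric] tscale_algA)
    show "\<forall>T\<in>\<pi> ` algA c. \<forall>U\<in>\<pi> ` algA c. T o\<^sub>L U \<in> \<pi> ` algA c"
      using c by (auto simp: algA_algN block_op_mult[symmetric] tmult_algA)
  qed (rule closed_block_op_algA)
  then show ?thesis
    by (simp add: operator_algebra_via_def subalgebra_algA algA_algN block_op_add block_op_scale
        block_op_mult[OF c] norm_block_op)
qed

text \<open>For fixed \<open>m\<close> the bound \<open>8m/k\<close> tends to 0; the other limit
  follows because polynomials in one shift commute.\<close>

lemma useq_algA:
  assumes "m \<ge> 1"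
  shows "useq m \<in> algA c"
proof -
  note u = useq_algN(1)[OF c]
  have "(\<lambda>k. norm ((\<pi> (useq k) o\<^sub>L \<pi> (useq m)) - \<pi> (useq m))) \<longlonglongrightarrow> 0"
  proof (rule tendsto_sandwich[where f = "\<lambda>_. 0"])
    show "\<forall>\<^sub>F k in sequentially. norm ((\<pi> (useq k) o\<^sub>L \<pi> (useq m)) - \<pi> (useq m)) \<le> 8 * real m / real k"
      using eventually_ge_at_top[of m]
      by eventually_elim (use pnorm_useq_mult_diff[OF c assms] in \<open>simp add: pnorm_mult_diff u\<close>)
    show "(\<lambda>k. 8 * real m / real k) \<longlonglongrightarrow> 0" by (rule lim_const_over_n)
  qed auto
  then have lim: "(\<lambda>k. \<pi> (useq k) o\<^sub>L \<pi> (useq m)) \<longlonglongrightarrow> \<pi> (useq m)"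
    by (simp add: tendsto_norm_zero_iff LIM_zero_iff)
  have "\<pi> (useq k) o\<^sub>L \<pi> (useq m) = \<pi> (useq m) o\<^sub>L \<pi> (useq k)" for k
    by (simp add: block_op_mult[OF c u u, symmetric] useq_commute[of k m])
  with lim have "(\<lambda>k. \<pi> (useq m) o\<^sub>L \<pi> (useq k)) \<longlonglongrightarrow> \<pi> (useq m)" by simp
  with lim show ?thesis using u unfolding algA_iff by blast
qed

lemma useq_approx_identity: "contractive_approx_identity (pnorm c) (algA c) useq"
  unfolding contractive_approx_identity_def
proof (intro conjI allI impI ballI)
  fix a assume a: "a \<in> algA c"
  then have "a \<in> algN c" by (rule algA_algN)
  then show "(\<lambda>k. pnorm c (tminus (tmult a (useq k)) a)) \<longlonglongrightarrow> 0"
    "(\<lambda>k. pnorm c (tminus (tmult (useq k) a) a)) \<longlonglongrightarrow> 0"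
    using a useq_algN(1)[OF c] by (simp_all add: pnorm_mult_diff algA_iff tendsto_norm_zero_iff LIM_zero_iff)
qed (use useq_algA useq_algN[OF c] in auto)

section \<open>The ideal \<open>A\<^sub>0\<close> and semisimplicity\<close>

lemma algA00_subset: "algA00 c \<subseteq> algA c"
proof
  fix y assume y: "y \<in> algA00 c"
  then have N: "y \<in> algN c" and fin: "finite {n. y n \<noteq> 0\<^sub>m n n}" by (auto simp: algA00_def)
  obtain M where "\<forall>n\<in>{n. y n \<noteq> 0\<^sub>m n n}. n < M" using fin unfolding finite_nat_set_iff_bounded by blast
  then have M: "y n = 0\<^sub>m n n" if "M \<le> n" for n using that by (auto simp: not_less[symmetric])
  \<comment> \<open>Every block is covered: for \<open>n < k\<close> the block of
    \<open>useq k\<close> is the identity, and for \<open>n \<ge> k \<ge> M\<close> that of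
    \<open>y\<close> is zero. The two limits are thus eventually constant.\<close>
  have eq: "tmult y (useq k) = y \<and> tmult (useq k) y = y" if "k \<ge> M" for k
  proof -
    have "y n * useq k n = y n \<and> useq k n * y n = y n" for n
    proof (cases "n < k")
      case True
      then show ?thesis using tuplesD[OF algN_tuples[OF N], of n] by (simp add: useq_def ublock_def)
    next
      case False
      then show ?thesis using M[of n] that tuplesD[OF useq_tuples, of k n] by simp
    qed
    then show ?thesis by (simp add: tmult_def)
  qed
  note u = useq_algN(1)[OF c]
  have "\<forall>\<^sub>F k in sequentially. \<pi> y o\<^sub>L \<pi> (useq k) = \<pi> y \<and> \<pi> (useq k) o\<^sub>L \<pi> y = \<pi> y"
    using eventually_ge_at_top[of M]
    by eventually_elim (use eq in \<open>simp add: block_op_mult[OF c, symmetric] N u\<close>)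
  then have "\<forall>\<^sub>F k in sequentially. \<pi> y o\<^sub>L \<pi> (useq k) = \<pi> y" "\<forall>\<^sub>F k in sequentially. \<pi> (useq k) o\<^sub>L \<pi> y = \<pi> y"
    by (auto simp: eventually_conj_iff)
  then show "y \<in> algA c"
    using N unfolding algA_iff by (blast intro: tendsto_eventually)
qed

lemma algA00_ops:
  assumes x: "x \<in> algA00 c"
  shows "y \<in> algA00 c \<Longrightarrow> tadd x y \<in> algA00 c" "tscale a x \<in> algA00 c"
    "z \<in> algN c \<Longrightarrow> tmult z x \<in> algA00 c" "z \<in> algN c \<Longrightarrow> tmult x z \<in> algA00 c"
proof -
  have N: "x \<in> algN c" and fin: "finite {n. x n \<noteq> 0\<^sub>m n n}" using x by (auto simp: algA00_def)
  show "tscale a x \<in> algA00 c"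
    using tscale_algN[OF N] by (auto simp: algA00_def tscale_def intro!: finite_subset[OF _ fin])
  show "tadd x y \<in> algA00 c" if "y \<in> algA00 c"
  proof -
    have y: "y \<in> algN c" "finite {n. y n \<noteq> 0\<^sub>m n n}" using that by (auto simp: algA00_def)
    have "finite {n. tadd x y n \<noteq> 0\<^sub>m n n}"
      by (rule finite_subset[OF _ finite_UnI[OF fin y(2)]]) (auto simp: tadd_def)
    then show ?thesis using tadd_algN[OF N y(1)] by (simp add: algA00_def)
  qed
  assume z: "z \<in> algN c"
  have "finite {n. tmult z x n \<noteq> 0\<^sub>m n n}" "finite {n. tmult x z n \<noteq> 0\<^sub>m n n}"
    using right_mult_zero_mat[OF tuplesD[OF algN_tuples[OF z]]] left_mult_zero_mat[OF tuplesD[OF algN_tuples[OF z]]]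
    by (auto intro!: finite_subset[OF _ fin] simp: tmult_def)
  then show "tmult z x \<in> algA00 c" "tmult x z \<in> algA00 c"
    using tmult_algN[OF c] N z by (simp_all add: algA00_def)
qed

lemma algA00_algN: "x \<in> algA00 c \<Longrightarrow> x \<in> algN c"
  by (simp add: algA00_def)

lemma algA0_iff: "x \<in> algA0 c \<longleftrightarrow> x \<in> algN c \<and> (\<forall>e>0. \<exists>y\<in>algA00 c. norm (\<pi> x - \<pi> y) < e)"
proof (cases "x \<in> algN c")
  case True
  have "pnorm c (tminus x y) = norm (\<pi> x - \<pi> y)" if "y \<in> algA00 c" for y
    using True algA00_algN[OF that] by (simp add: block_op_minus[symmetric] norm_block_op tminus_algN)
  then show ?thesis using True by (auto simp: algA0_def)
qed (simp add: algA0_def)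

text \<open>A map of \<open>N\<close> that is Lipschitz and preserves the finitely supported tuples
  also preserves their closure. It is applied to scaling and to multiplication from either
  side.\<close>

lemma algA0_imageI:
  assumes x: "x \<in> algA0 c" and f: "\<And>z. z \<in> algN c \<Longrightarrow> f z \<in> algN c" "\<And>y. y \<in> algA00 c \<Longrightarrow> f y \<in> algA00 c"
    and "0 \<le> C" and le: "\<And>y. y \<in> algA00 c \<Longrightarrow> norm (\<pi> (f x) - \<pi> (f y)) \<le> C * norm (\<pi> x - \<pi> y)"
  shows "f x \<in> algA0 c"
  unfolding algA0_iff
proof (intro conjI allI impI)
  show "f x \<in> algN c" using x f(1) by (simp add: algA0_iff)
  fix e :: real assume "e > 0"
  \<comment> \<open>Adding 1 keeps the denominator positive when \<open>C = 0\<close>.\<close>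
  then have "e / (C + 1) > 0" using \<open>0 \<le> C\<close> by simp
  then obtain y where y: "y \<in> algA00 c" "norm (\<pi> x - \<pi> y) < e / (C + 1)"
    using x unfolding algA0_iff by blast
  have "norm (\<pi> (f x) - \<pi> (f y)) \<le> (C + 1) * norm (\<pi> x - \<pi> y)"
    using le[OF y(1)] by (simp add: distrib_right add_increasing2)
  also have "\<dots> < e" using y(2) \<open>0 \<le> C\<close> by (simp add: pos_less_divide_eq mult.commute)
  finally show "\<exists>y\<in>algA00 c. norm (\<pi> (f x) - \<pi> y) < e" using f(2)[OF y(1)] by blast
qed

lemma two_sided_ideal_algA0: "two_sided_ideal (algA c) (algA0 c)"
  unfolding two_sided_ideal_def left_ideal_def
proof (intro conjI ballI allI)
  show "algA0 c \<subseteq> algA c"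
  proof
    fix x assume "x \<in> algA0 c"
    \<comment> \<open>Finitely supported tuples lie in \<open>A\<close>, and \<open>A\<close> is
      closed in \<open>N\<close>.\<close>
    then show "x \<in> algA c" using algA00_subset unfolding algA0_iff by (intro algA_closed) blast+
  qed
  have "tzero \<in> algA00 c" using tzero_algN by (simp add: algA00_def tzero_def)
  then show "tzero \<in> algA0 c" using tzero_algN unfolding algA0_iff by (auto intro: bexI[of _ tzero])
next
  fix x y assume x: "x \<in> algA0 c" and y: "y \<in> algA0 c"
  then have N: "x \<in> algN c" "y \<in> algN c" by (auto simp: algA0_iff)
  show "tadd x y \<in> algA0 c"
    unfolding algA0_iff
  proof (intro conjI allI impI)
    show "tadd x y \<in> algN c" using N by (rule tadd_algN)
    fix e :: real assume "e > 0"
    then have "e / 2 > 0" by simp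
    then obtain x' y' where xy: "x' \<in> algA00 c" "y' \<in> algA00 c" "norm (\<pi> x - \<pi> x') < e / 2" "norm (\<pi> y - \<pi> y') < e / 2"
      using x y unfolding algA0_iff by meson
    have "norm (\<pi> (tadd x y) - \<pi> (tadd x' y')) < e"
      using norm_diff_triangle_ineq[of "\<pi> x" "\<pi> y" "\<pi> x'" "\<pi> y'"] xy
      by (simp add: block_op_add N algA00_algN)
    then show "\<exists>z\<in>algA00 c. norm (\<pi> (tadd x y) - \<pi> z) < e" using algA00_ops(1)[OF xy(1,2)] by blast
  qed
next
  fix a x assume x: "x \<in> algA0 c"
  then have N: "x \<in> algN c" by (simp add: algA0_iff)
  show "tscale a x \<in> algA0 c"
    using x by (rule algA0_imageI[where C = "cmod a"])
      (auto intro: tscale_algN algA00_ops norm_block_op_tscale_diff N algA00_algN)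
next
  fix a x assume a: "a \<in> algA c" and x: "x \<in> algA0 c"
  note Na = algA_algN[OF a]
  have N: "x \<in> algN c" using x by (simp add: algA0_iff)
  show "tmult a x \<in> algA0 c"
    using x
  proof (rule algA0_imageI[where C = "norm (\<pi> a)"])
    show "norm (\<pi> (tmult a x) - \<pi> (tmult a y)) \<le> norm (\<pi> a) * norm (\<pi> x - \<pi> y)" if "y \<in> algA00 c" for y
      using norm_blinfun_compose[of "\<pi> a" "\<pi> x - \<pi> y"]
      by (simp add: block_op_mult[OF c] Na N algA00_algN that blinfun_compose.diff_right)
  qed (auto intro: tmult_algN[OF c] Na algA00_ops)
next
  fix a x assume a: "a \<in> algA c" and x: "x \<in> algA0 c"
  note Na = algA_algN[OF a]
  have N: "x \<in> algN c" using x by (simp add: algA0_iff)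
  show "tmult x a \<in> algA0 c"
    using x
  proof (rule algA0_imageI[where C = "norm (\<pi> a)"])
    show "norm (\<pi> (tmult x a) - \<pi> (tmult y a)) \<le> norm (\<pi> a) * norm (\<pi> x - \<pi> y)" if "y \<in> algA00 c" for y
      using norm_blinfun_compose[of "\<pi> x - \<pi> y" "\<pi> a"]
      by (simp add: block_op_mult[OF c] Na N algA00_algN that blinfun_compose.diff_left mult.commute)
  qed (auto intro: tmult_algN[OF c] Na algA00_ops)
qed

end

section \<open>Semisimplicity: annihilators of single vectors\<close>

definition single :: "nat \<Rightarrow> complex mat \<Rightarrow> mtuple" where
  "single n X = (\<lambda>k. if k = n then X else 0\<^sub>m k k)"

lemma single_algA00:
  assumes X: "X \<in> carrier_mat n n"
  shows "single n X \<in> algA00 c"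
proof -
  have t: "single n X \<in> tuples" using X by (simp add: tuples_def single_def)
  have "single n X \<in> algN c"
  proof (rule algNI[OF t])
    fix k b
    show "opnorm (block c (single n X) k b) \<le> opnorm (block c (single n X) n False) + opnorm (block c (single n X) n True)"
    proof (cases "k = n")
      case False
      then have "block c (single n X) k b = block c tzero k b"
        by (simp add: block_def dconj_def single_def tzero_def)
      then have "opnorm (block c (single n X) k b) \<le> 0"
        by (intro opnorm_le[of _ k k]) (auto simp: block_tzero zero_mat_mult_vec)
      then show ?thesis by (simp add: add_nonneg_nonneg order_trans)
    qed (cases b; simp)
  qed
  moreover have "finite {k. single n X k \<noteq> 0\<^sub>m k k}"
    by (rule finite_subset[of _ "{n}"]) (auto simp: single_def)
  ultimately show ?thesis by (simp add: algA00_def)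
qed

text \<open>Since \<open>A\<close> contains every \<open>single n X\<close>, it acts transitively on \<open>\<complex>\<^sup>n\<close>.\<close>

lemma maximal_modular_annihilator:
  assumes c: "\<forall>n\<ge>1. c n > 1" and v: "v \<in> carrier_vec n" "v \<noteq> 0\<^sub>v n"
  shows "maximal_modular_left_ideal (algA c) {a \<in> algA c. a n *\<^sub>v v = 0\<^sub>v n}" (is "maximal_modular_left_ideal _ ?J")
proof -
  note A = subalgebra_algA[OF c, unfolded subalgebra_def]
  have car: "a n \<in> carrier_mat n n" if "a \<in> algA c" for a using A that tuplesD by blast
  have single: "single n X \<in> algA c" if "X \<in> carrier_mat n n" for X
    using single_algA00[OF that] algA00_subset[OF c] by blast
  have minus: "tminus a b \<in> algA c" if "a \<in> algA c" "b \<in> algA c" for a b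
  proof -
    have "a \<in> tuples" "b \<in> tuples" using A that by blast+
    then show ?thesis using A that by (simp add: tminus_eq)
  qed
  have left: "left_ideal (algA c) ?J"
    unfolding left_ideal_def
  proof (intro conjI ballI allI)
    show "tzero \<in> ?J" using A v by (simp add: tzero_def zero_mat_mult_vec)
    show "tadd x y \<in> ?J" if "x \<in> ?J" "y \<in> ?J" for x y
      using that A v car by (auto simp: tadd_def add_mult_distrib_mat_vec[of _ n n])
    show "tscale a x \<in> ?J" if "x \<in> ?J" for a x
      using that A v car by (auto simp: tscale_def smult_mat_mult_vec[of _ n n])
    show "tmult a x \<in> ?J" if "a \<in> algA c" "x \<in> ?J" for a x
      using that A v car[of a] car[of x] by (auto simp: tmult_def assoc_mult_mat_vec[of _ n n _ n])
  qed auto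
  \<comment> \<open>The modular unit: block \<open>n\<close> of \<open>a - a e\<close> is zero and
    hence annihilates \<open>v\<close>, while \<open>e\<close> itself fixes \<open>v\<close> and so
    lies outside the annihilator.\<close>
  let ?e = "single n (1\<^sub>m n)"
  have e: "?e \<in> algA c" by (rule single) simp
  have "tminus a (tmult a ?e) \<in> ?J" if "a \<in> algA c" for a
  proof -
    have "tminus a (tmult a ?e) n = 0\<^sub>m n n"
      using car[OF that] by (simp add: tminus_def tmult_def single_def minus_r_inv_mat)
    then show ?thesis using minus that e A v by (simp add: zero_mat_mult_vec)
  qed
  then have modular: "modular_left_ideal (algA c) ?J"
    unfolding modular_left_ideal_def using left e by blast
  have "?e \<notin> ?J" using v by (simp add: single_def)
  then have proper: "?J \<noteq> algA c" using e by blast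
  have "K = ?J" if K: "left_ideal (algA c) K" "?J \<subseteq> K" "K \<noteq> algA c" for K
  proof (rule ccontr)
    assume "K \<noteq> ?J"
    \<comment> \<open>By transitivity, some multiple \<open>y\<close> of \<open>k\<close> agrees
      with any given \<open>a\<close> on \<open>v\<close>; then \<open>a - y\<close> lies in the
      annihilator and \<open>a = (a - y) + y\<close> lies in \<open>K\<close>.\<close>
    then obtain k where k: "k \<in> K" "k \<in> algA c" "k n *\<^sub>v v \<noteq> 0\<^sub>v n"
      using K(1,2) unfolding left_ideal_def by blast
    define w where "w = k n *\<^sub>v v"
    have w: "w \<in> carrier_vec n" using car[OF k(2)] v by (simp add: w_def)
    obtain i where i: "i < n" "vec_index w i \<noteq> 0"
      using k(3) w unfolding w_def[symmetric] by (metis carrier_vecD eq_vecI index_zero_vec)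
    have "a \<in> K" if a: "a \<in> algA c" for a
    proof -
      define z where "z = a n *\<^sub>v v"
      have z: "z \<in> carrier_vec n" using car[OF a] v by (simp add: z_def)
      \<comment> \<open>A matrix of rank at most one that reads off the nonzero coordinate
        \<open>i\<close> of \<open>w\<close> and returns \<open>z\<close>.\<close>
      define Y where "Y = Matrix.mat n n (\<lambda>(r, s). if s = i then vec_index z r / vec_index w i else 0)"
      have Y: "Y \<in> carrier_mat n n" by (simp add: Y_def)
      have "Y *\<^sub>v w = z"
      proof (rule eq_vecI)
        fix r assume "r < dim_vec z"
        then have r: "r < n" using z by simp
        have "vec_index (Y *\<^sub>v w) r = (\<Sum>s<n. if s = i then vec_index z r else 0)"
          unfolding mult_mat_vec_nth[OF Y w r] using r i by (intro sum.cong) (auto simp: Y_def)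
        then show "vec_index (Y *\<^sub>v w) r = vec_index z r" using i by simp
      qed (use z Y in auto)
      then have Yk: "(Y * k n) *\<^sub>v v = z"
        using Y car[OF k(2)] v by (simp add: w_def assoc_mult_mat_vec[of _ n n _ n])
      let ?y = "tmult (single n Y) k"
      have y: "?y \<in> K" "?y \<in> algA c" using K(1) k single[OF Y] unfolding left_ideal_def by blast+
      have "tminus a ?y n *\<^sub>v v = z - (Y * k n) *\<^sub>v v"
        using car[OF a] Y car[OF k(2)] v
        by (simp add: tminus_def tmult_def single_def z_def minus_mult_distrib_mat_vec[of _ n n])
      then have "tminus a ?y \<in> ?J" using minus[OF a y(2)] z by (simp add: Yk)
      then have "tadd (tminus a ?y) ?y \<in> K" using K(1,2) y(1) unfolding left_ideal_def by blast
      moreover have "tadd (tminus a ?y) ?y = a"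
      proof
        fix m
        have "a m \<in> carrier_mat m m" "?y m \<in> carrier_mat m m" using A a y(2) tuplesD by blast+
        then show "tadd (tminus a ?y) ?y m = a m"
          by (intro eq_matI) (auto simp: tadd_def tminus_def)
      qed
      ultimately show ?thesis by simp
    qed
    then show False using K(1,3) unfolding left_ideal_def by blast
  qed
  then show ?thesis
    unfolding maximal_modular_left_ideal_def using modular proper by blast
qed

text \<open>An element of the radical lies in the annihilator of every unit vector of every C^n, so
  all columns of all its blocks vanish.\<close>

lemma semisimple_algA:
  assumes c: "\<forall>n\<ge>1. c n > 1"
  shows "semisimple (algA c)"
  unfolding semisimple_def
proof (intro equalityI subsetI)
  fix x assume x: "x \<in> jacobson_radical (algA c)"
  then have "x \<in> tuples" 
    by (auto simp: jacobson_radical_def intro: algN_tuples algA_algN[OF c])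
  have "x n = 0\<^sub>m n n" for n
  proof (rule eq_matI)
    note X = tuplesD[OF \<open>x \<in> tuples\<close>, of n]
    fix i j assume "i < dim_row (0\<^sub>m n n :: complex mat)" "j < dim_col (0\<^sub>m n n :: complex mat)"
    then have ij: "i < n" "j < n" by auto
    have "vec_index (unit_vec n j :: complex vec) j \<noteq> vec_index (0\<^sub>v n) j" using ij by simp
    then have "maximal_modular_left_ideal (algA c) {a \<in> algA c. a n *\<^sub>v unit_vec n j = 0\<^sub>v n}"
      by (intro maximal_modular_annihilator[OF c]) auto
    then have "x n *\<^sub>v unit_vec n j = 0\<^sub>v n" using x unfolding jacobson_radical_def by blast
    then have "vec_index (x n *\<^sub>v unit_vec n j) i = 0" using ij by simp
    then show "x n $$ (i, j) = 0\<^sub>m n n $$ (i, j)"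
      using X ij by (simp add: scalar_prod_right_unit)
  qed (use tuplesD[OF \<open>x \<in> tuples\<close>, of n] in auto)
  then show "x \<in> {tzero}" by (auto simp: tzero_def)
next
  fix x assume "x \<in> {tzero}"
  then show "x \<in> jacobson_radical (algA c)"
    using tzero_algA[OF c]
    by (auto simp: jacobson_radical_def maximal_modular_left_ideal_def modular_left_ideal_def left_ideal_def)
qed

theorem corollary2p3:
  fixes c :: "nat \<Rightarrow> real"
  assumes "\<forall>n\<ge>1. c n > 1"
    and "mono_on {1..} c"
    and "\<not> bdd_above (c ` {1..})"
  shows "operator_algebra_via (block_op c) (pnorm c) (algA c) \<and>
         semisimple (algA c) \<and>
         contractive_approx_identity (pnorm c) (algA c) useq \<and>
         two_sided_ideal (algA c) (algA0 c)"
  using operator_algebra_algA semisimple_algA useq_approx_identity two_sided_ideal_algA0 assms(1)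
  by blast

end
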